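(* Let $\Gamma_1,\Gamma_2$ be non-empty sets of cycles, let $n=\gamma^1$ and $k=\gamma_e^2$, and assume that either - $n\geq 5$ and $\gamma^2=3$, or - $n\geq 6$, $\gamma^2=5$, and $k\geq 8$. Then a red-blue graph $G$ is $(\Gamma_1,\Gamma_2)$-critical if and only if $G_{\mathrm{blue}}\subseteq K_{p,q}$, where $p+q=|G|$ and $p\geq q$ (that is, $V(G)$ is partitioned into two parts of sizes $p$ and $q$ with all edges inside each part red, so that the parts induce a red $K_p$ and a red $K_q$), and, moreover: if $2n>k$, then either (1) $p=n-1$, $q=k/2-1$, and all red edges (if any) between $K_{n-1}$ and $K_{k/2-1}$ are incident with a common vertex in $K_{n-1}$, or (2) $p=n-2$, $q=k/2$, there is a vertex $x\in K_{k/2}$ such that there are $n-3$ or $n-2$ red edges between $x$ and $K_{n-2}$, and all other edges between $K_{n-2}$ and $K_{k/2}$ are blue; while if $2n\leq k$, then $p=q=n-1$ and there is at most one red edge between the two $K_{n-1}$.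
   Context: All graphs are finite, simple and undirected; $C_k$ ($k\ge 3$) is the cycle of length $k$. A red-blue graph is a complete graph with each edge coloured red or blue; $G_{\mathrm{blue}}$ is the graph on $V(G)$ whose edges are the blue edges, and $|G|=|V(G)|$. $R(\Gamma_1,\Gamma_2)$ is the least positive integer $N$ such that each red-blue graph on $N$ vertices contains a red subgraph from $\Gamma_1$ or a blue subgraph from $\Gamma_2$. A red-blue graph is $(\Gamma_1,\Gamma_2)$-avoiding if it contains neither a red subgraph from $\Gamma_1$ nor a blue subgraph from $\Gamma_2$; it is $(\Gamma_1,\Gamma_2)$-critical if moreover it has $R(\Gamma_1,\Gamma_2)-1$ vertices. For $i\in\{1,2\}$, $\gamma^i=\min\{k\mid C_k\in\Gamma_i\}$ and $\gamma_e^i=\min\{k \text{ even}\mid C_k\in\Gamma_i\}$, with $\gamma_e^i=\infty$ if $\Gamma_i$ contains no even cycle (so $2n\le k$ when $k=\infty$). *)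

theory Defs
  imports Main "HOL-Library.Extended_Nat"
begin

type_synonym 'a graph = "'a set \<times> 'a set set"

definition subgraph :: "'a graph \<Rightarrow> 'a graph \<Rightarrow> bool" where
  "subgraph H G \<longleftrightarrow> fst H \<subseteq> fst G \<and> snd H \<subseteq> snd G"

text \<open>\<open>H\<close> is isomorphic to a (not necessarily induced) subgraph of \<open>G\<close>.\<close>

definition contains_copy :: "'b graph \<Rightarrow> 'a graph \<Rightarrow> bool" where
  "contains_copy H G \<longleftrightarrow>
     (\<exists>f. inj_on f (fst H) \<and> subgraph (f ` fst H, (\<lambda>e. f ` e) ` snd H) G)"

text \<open>This is the cycle \<open>C\<^sub>k\<close> only for \<open>k \<ge> 3\<close>.\<close>

definition cycle :: "nat \<Rightarrow> nat graph" where
  "cycle k = ({..<k}, {{i, Suc i mod k} | i. i < k})"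

definition cycles :: "nat graph set" where
  "cycles = cycle ` {3..}"

definition complete_bipartite :: "'a set \<Rightarrow> 'a set \<Rightarrow> 'a graph" where
  "complete_bipartite A B = (A \<union> B, {{a, b} | a b. a \<in> A \<and> b \<in> B})"

datatype colour = Red | Blue

text \<open>A complete graph on \<open>verts\<close> with coloured edges. Only the values of \<open>col\<close> on
  two-element subsets of \<open>verts\<close> matter.\<close>

record 'a red_blue =
  verts :: "'a set"
  col :: "'a set \<Rightarrow> colour"

definition red_blue_graph :: "'a red_blue \<Rightarrow> bool" where
  "red_blue_graph G \<longleftrightarrow> finite (verts G)"

definition order :: "'a red_blue \<Rightarrow> nat" where
  "order G = card (verts G)"

definition colour_graph :: "colour \<Rightarrow> 'a red_blue \<Rightarrow> 'a graph" where
  "colour_graph c G =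
     (verts G, {{u, v} | u v. u \<in> verts G \<and> v \<in> verts G \<and> u \<noteq> v \<and> col G {u, v} = c})"

abbreviation red_graph :: "'a red_blue \<Rightarrow> 'a graph" where
  "red_graph \<equiv> colour_graph Red"

abbreviation blue_graph :: "'a red_blue \<Rightarrow> 'a graph" where
  "blue_graph \<equiv> colour_graph Blue"

definition avoiding :: "nat graph set \<Rightarrow> nat graph set \<Rightarrow> 'a red_blue \<Rightarrow> bool" where
  "avoiding \<Gamma>1 \<Gamma>2 G \<longleftrightarrow>
     \<not> (\<exists>H\<in>\<Gamma>1. contains_copy H (red_graph G)) \<and>
     \<not> (\<exists>H\<in>\<Gamma>2. contains_copy H (blue_graph G))"

text \<open>Quantifying over red-blue graphs with vertices in \<open>nat\<close> loses no generality, as every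
  finite red-blue graph is isomorphic to one of these.\<close>

definition ramsey_number :: "nat graph set \<Rightarrow> nat graph set \<Rightarrow> nat" where
  "ramsey_number \<Gamma>1 \<Gamma>2 =
     (LEAST N. 0 < N \<and>
        (\<forall>G :: nat red_blue. red_blue_graph G \<and> order G = N \<longrightarrow>
           (\<exists>H\<in>\<Gamma>1. contains_copy H (red_graph G)) \<or>
           (\<exists>H\<in>\<Gamma>2. contains_copy H (blue_graph G))))"

definition critical :: "nat graph set \<Rightarrow> nat graph set \<Rightarrow> 'a red_blue \<Rightarrow> bool" where
  "critical \<Gamma>1 \<Gamma>2 G \<longleftrightarrow>
     avoiding \<Gamma>1 \<Gamma>2 G \<and> order G = ramsey_number \<Gamma>1 \<Gamma>2 - 1"

definition min_cycle :: "nat graph set \<Rightarrow> nat" where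
  "min_cycle \<Gamma> = (LEAST k. 3 \<le> k \<and> cycle k \<in> \<Gamma>)"

text \<open>The infimum of the empty set in \<open>enat\<close> is \<open>\<infinity>\<close>; otherwise it is the minimum.\<close>

definition min_even_cycle :: "nat graph set \<Rightarrow> enat" where
  "min_even_cycle \<Gamma> = Inf {enat k | k. 3 \<le> k \<and> even k \<and> cycle k \<in> \<Gamma>}"

definition red_edges_between :: "'a red_blue \<Rightarrow> 'a set \<Rightarrow> 'a set \<Rightarrow> 'a set set" where
  "red_edges_between G A B =
     {e \<in> snd (red_graph G). \<exists>a\<in>A. \<exists>b\<in>B. e = {a, b}}"

end

theory Submission
  imports Defs
begin

text \<open>
  If a red cycle of length greater than \<open>n\<close> cannot be shortened by one, then all its chords of
  length two are blue, and these, together with the chords of length three and four, produce a blue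
  triangle or pentagon; a red \<open>K\<^sub>4\<^sub>,\<^sub>4\<close> is the only obstacle and needs a vertex outside
  the cycle. So all red cycles are shorter than \<open>n\<close>. Every vertex outside a longest red cycle
  \<open>C\<close> then has at most one red neighbour on \<open>C\<close>, since two of them would give a blue
  triangle or pentagon, or a longer red cycle. Hence the outside vertices form a red clique, every
  blue chord of \<open>C\<close> ends in a vertex joined in red to all outside vertices, and it follows that
  the vertex set is the union of two disjoint red cliques.

  As there is no red \<open>C\<^sub>n\<close>, the red edges between the two cliques form a star, and the
  absence of a blue \<open>C\<^sub>k\<close> determines the sizes of the cliques. Conversely, in these graphs
  the centre of the star is a cut vertex of the red graph. The Ramsey number itself comes out on the
  way, because the argument needs only a lower bound on the number of vertices.
\<close>

section \<open>Cycles as lists\<close>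

text \<open>The forward direction draws on three forbidden cycles: red C_n, blue C_3 or C_5, and
  blue C_k. In the converse every red cycle is shorter than n, and the blue graph is bipartite with
  all its cycles shorter than k, so the remaining members of the families are absent as well.

  The bounds on n mark where shortening stops. A red C_5 whose complement is a blue C_5 has neither
  a red C_4 nor a blue triangle; a red K_3,3 has a red C_6, but neither a red C_5 nor a blue C_5.

  The order is at least n + k/2 - 2 or 2n - 2, so in the pentagon case k \<ge> 8 gives at least n +
  2 vertices. This surplus serves twice: for n = 7 it supplies the vertex outside a red C_8 that
  defeats K_4,4, and it leaves three vertices outside a longest red cycle, from which the blue
  pentagons are built. For n = 6 a red C_8 may cover everything, but then a red chord closes a C_6
  directly.\<close>

text \<open>The closing edge runs from \<open>last xs\<close> to \<open>hd xs\<close>. Under a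
  symmetric relation a single edge counts as a cycle of length two; where genuine cycles matter, a
  length of at least 3 is asked for separately.\<close>

definition is_cycle :: "('a \<Rightarrow> 'a \<Rightarrow> bool) \<Rightarrow> 'a set \<Rightarrow> 'a list \<Rightarrow> bool" where
  "is_cycle E V xs \<longleftrightarrow>
     set xs \<subseteq> V \<and> distinct xs \<and> xs \<noteq> [] \<and> successively E xs \<and> E (last xs) (hd xs)"

definition has_cycle :: "('a \<Rightarrow> 'a \<Rightarrow> bool) \<Rightarrow> 'a set \<Rightarrow> nat \<Rightarrow> bool" where
  "has_cycle E V m \<longleftrightarrow> (\<exists>xs. is_cycle E V xs \<and> length xs = m)"

lemma has_cycleI: "is_cycle E V xs \<Longrightarrow> length xs = m \<Longrightarrow> has_cycle E V m"
  unfolding has_cycle_def by blast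

lemma is_cycle_append_commute: "is_cycle E V (xs @ ys) \<Longrightarrow> is_cycle E V (ys @ xs)"
  by (cases "xs = []"; cases "ys = []")
     (auto simp: is_cycle_def successively_append_iff)

lemma is_cycle_rotate:
  assumes "is_cycle E V xs"
  shows "is_cycle E V (rotate i xs)"
proof -
  have "is_cycle E V (take (i mod length xs) xs @ drop (i mod length xs) xs)"
    using assms by simp
  then show ?thesis
    unfolding rotate_drop_take by (rule is_cycle_append_commute)
qed

lemma is_cycle_length_le:
  assumes "is_cycle E V xs" "finite V"
  shows "length xs \<le> card V"
  using assms by (metis card_mono distinct_card is_cycle_def)

lemma is_cycle_Cons_obtain:
  assumes "is_cycle E V xs" "x \<in> set xs"
  obtains ys where "is_cycle E V (x # ys)" "set (x # ys) = set xs" "length (x # ys) = length xs"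
proof -
  obtain us vs where xs: "xs = us @ x # vs"
    using assms(2) by (meson split_list)
  show thesis
  proof (rule that)
    show "is_cycle E V (x # vs @ us)"
      using is_cycle_append_commute[of E V us "x # vs"] assms xs by simp
  qed (auto simp: xs)
qed

lemma is_cycle_Cons_Cons_obtain:
  assumes "is_cycle E V xs" "x \<in> set xs" "y \<in> set xs" "x \<noteq> y"
  obtains ys zs where "is_cycle E V (x # ys @ y # zs)" "set (x # ys @ y # zs) = set xs"
    "length (x # ys @ y # zs) = length xs"
proof -
  obtain us where us: "is_cycle E V (x # us)" "set (x # us) = set xs" "length (x # us) = length xs"
    using is_cycle_Cons_obtain assms(1,2) by metis
  then have "y \<in> set us"
    using assms by auto
  then obtain ys zs where "us = ys @ y # zs"
    by (meson split_list)
  with us that show thesis by blast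
qed

lemma successively_rev_sym:
  assumes "symp E"
  shows "successively E (rev xs) \<longleftrightarrow> successively E xs"
proof -
  have "(\<lambda>x y. E y x) = E"
    using assms by (auto simp: fun_eq_iff dest: sympD)
  then show ?thesis
    unfolding successively_rev by metis
qed

lemma distinct_list_obtain:
  assumes "finite A" "m \<le> card A"
  obtains xs where "distinct xs" "set xs \<subseteq> A" "length xs = m"
proof -
  obtain S where "S \<subseteq> A" "card S = m" "finite S"
    using obtain_subset_with_card_n[OF assms(2)] by auto
  then show thesis
    using that finite_distinct_list distinct_card by metis
qed

definition longest_cycle :: "('a \<Rightarrow> 'a \<Rightarrow> bool) \<Rightarrow> 'a set \<Rightarrow> 'a list \<Rightarrow> bool" where
  "longest_cycle E V xs \<longleftrightarrow>
     is_cycle E V xs \<and> (\<forall>ys. is_cycle E V ys \<longrightarrow> length ys \<le> length xs)"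

lemma longest_cycle_exists:
  assumes "finite V" "is_cycle E V zs"
  obtains xs where "longest_cycle E V xs" "length zs \<le> length xs"
proof -
  let ?P = "\<lambda>m. \<exists>xs. is_cycle E V xs \<and> length xs = m"
  have bound: "\<And>m. ?P m \<Longrightarrow> m \<le> card V"
    using is_cycle_length_le assms(1) by blast
  have "?P (length zs)"
    using assms(2) by blast
  then have "?P (Greatest ?P)" "\<And>m. ?P m \<Longrightarrow> m \<le> Greatest ?P"
    using GreatestI_nat[of ?P] Greatest_le_nat[of ?P] bound by blast+
  then show thesis
    using that assms(2) unfolding longest_cycle_def by metis
qed

section \<open>Two-colourings given by a red relation and its complement\<close>

locale red_blue_relation =
  fixes V :: "'a set" and R :: "'a \<Rightarrow> 'a \<Rightarrow> bool"
  assumes finite_V: "finite V"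
    and R_sym: "R x y \<Longrightarrow> R y x"
    and R_irrefl: "\<not> R x x"
begin

definition B :: "'a \<Rightarrow> 'a \<Rightarrow> bool" where
  "B x y \<longleftrightarrow> x \<noteq> y \<and> \<not> R x y"

lemma B_sym: "B x y \<Longrightarrow> B y x"
  using R_sym unfolding B_def by blast

lemma R_commute: "R x y \<longleftrightarrow> R y x"
  using R_sym by blast

lemma B_commute: "B x y \<longleftrightarrow> B y x"
  using B_sym by blast

lemma not_R_iff: "x \<noteq> y \<Longrightarrow> \<not> R x y \<longleftrightarrow> B x y"
  unfolding B_def by blast

lemma symp_R: "symp R"
  using R_sym by (simp add: sympI)

lemma triangle_cycle:
  assumes "\<not> has_cycle B V 3" "a \<in> V" "b \<in> V" "c \<in> V" "distinct [a,b,c]" "B a b" "B b c"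
  shows "R a c"
proof (rule ccontr)
  assume "\<not> R a c"
  then have "is_cycle B V [a,b,c]"
    using assms B_commute[of c a] not_R_iff[of a c] by (auto simp: is_cycle_def)
  then show False
    using assms(1) by (auto simp: has_cycle_def)
qed

text \<open>If shortening fails, chords of length two are blue, and on six vertices three of them
  form a blue triangle. On more vertices, consecutive blue chords force \<open>a0 a4\<close> and
  \<open>a2 a6\<close> to be red. Each detour below reverses an inner segment and omits only
  \<open>a1\<close>: the first makes \<open>a2 a5\<close> blue, hence \<open>a0 a5\<close> red, and
  the second closes the forbidden shorter cycle.\<close>

lemma red_cycle_shorten:
  assumes no3: "\<not> has_cycle B V 3" and cyc: "is_cycle R V xs" and len: "length xs \<ge> 6"
  shows "has_cycle R V (length xs - 1)"
proof (cases "length xs = 6")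
  case True
  then obtain a0 a1 a2 a3 a4 a5 where xs: "xs = [a0,a1,a2,a3,a4,a5]"
    by (auto simp: length_Suc_conv numeral_eq_Suc)
  show ?thesis
  proof (rule ccontr)
    assume neg: "\<not> has_cycle R V (length xs - 1)"
    have V: "set xs \<subseteq> V" "distinct xs" using cyc by (auto simp: is_cycle_def)
    have "\<not> R a0 a2" "\<not> R a2 a4" "\<not> R a4 a0"
      using neg cyc has_cycleI[of R V "[a0,a2,a3,a4,a5]"] has_cycleI[of R V "[a0,a1,a2,a4,a5]"]
        has_cycleI[of R V "[a0,a1,a2,a3,a4]"]
      by (auto simp: xs is_cycle_def)
    then have "is_cycle B V [a0,a2,a4]"
      using V unfolding B_def xs by (auto simp: is_cycle_def)
    then show False using no3 by (auto simp: has_cycle_def)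
  qed
next
  case False
  then have "length xs \<ge> 7" using len by simp
  then obtain a0 a1 a2 a3 a4 a5 a6 ys where xs: "xs = a0#a1#a2#a3#a4#a5#a6#ys"
    by (auto simp: Suc_le_length_iff numeral_eq_Suc)
  show ?thesis
  proof (rule ccontr)
    assume "\<not> has_cycle R V (length xs - 1)"
    then have neg: "\<And>zs. length zs = Suc (Suc (Suc (Suc (Suc (Suc (length ys)))))) \<Longrightarrow> \<not> is_cycle R V zs"
      by (auto simp: has_cycle_def xs)
    have V: "set xs \<subseteq> V" "distinct xs" using cyc by (auto simp: is_cycle_def)
    have "\<not> R a0 a2" using neg[of "a0#a2#a3#a4#a5#a6#ys"] cyc by (auto simp: xs is_cycle_def)
    moreover have "\<not> R a1 a3" using neg[of "a0#a1#a3#a4#a5#a6#ys"] cyc by (auto simp: xs is_cycle_def)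
    moreover have "\<not> R a2 a4" using neg[of "a0#a1#a2#a4#a5#a6#ys"] cyc by (auto simp: xs is_cycle_def)
    moreover have "\<not> R a3 a5" using neg[of "a0#a1#a2#a3#a5#a6#ys"] cyc by (auto simp: xs is_cycle_def)
    moreover have "\<not> R a4 a6" using neg[of "a0#a1#a2#a3#a4#a6#ys"] cyc by (auto simp: xs is_cycle_def)
    ultimately have blue: "B a0 a2" "B a1 a3" "B a2 a4" "B a3 a5" "B a4 a6"
      using V unfolding B_def xs by auto
    have "R a0 a4" using triangle_cycle[OF no3, of a0 a2 a4] blue V by (auto simp: xs)
    moreover have "R a2 a6" using triangle_cycle[OF no3, of a2 a4 a6] blue V by (auto simp: xs)
    moreover have "\<not> R a2 a5"
      using neg[of "a0#a4#a3#a2#a5#a6#ys"] cyc \<open>R a0 a4\<close> by (auto simp: xs is_cycle_def R_commute)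
    moreover from this have "R a0 a5"
      using triangle_cycle[OF no3, of a0 a2 a5] blue V unfolding B_def by (auto simp: xs)
    ultimately show False
      using neg[of "a0#a5#a4#a3#a2#a6#ys"] cyc by (auto simp: xs is_cycle_def R_commute)
  qed
qed

end

section \<open>Shortening red cycles without a blue pentagon\<close>

context red_blue_relation
begin

lemma blue_pentagon_False:
  assumes "\<not> has_cycle B V 5" "B a b" "B b c" "B c d" "B d e" "B e a"
    "distinct [a,b,c,d,e]" "set [a,b,c,d,e] \<subseteq> V"
  shows False
proof -
  have "is_cycle B V [a,b,c,d,e]"
    using assms by (simp add: is_cycle_def)
  then show False
    using assms(1) by (auto simp: has_cycle_def)
qed

lemma step_two_blue:
  assumes "is_cycle R V (a#b#c#ys)" "\<not> has_cycle R V (Suc (Suc (length ys)))"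
  shows "B a c"
proof (rule ccontr)
  assume "\<not> B a c"
  then have "is_cycle R V (a#c#ys)"
    using assms(1) by (auto simp: is_cycle_def B_def)
  then show False
    using assms(2) by (auto simp: has_cycle_def)
qed

text \<open>A red chord \<open>a1 a5\<close> allows reversing a segment, so \<open>a2 a7\<close> and
  \<open>a0 a3\<close> must be blue: if red, they would close cycles omitting only \<open>a6\<close>
  and \<open>a4\<close>. With three blue chords of length two this gives the pentagon
  \<open>a0 a2 a7 a5 a3\<close>.\<close>

lemma step_four_blue:
  assumes no5: "\<not> has_cycle B V 5" and cyc: "is_cycle R V (a0#a1#a2#a3#a4#a5#a6#a7#ys)"
    and neg: "\<not> has_cycle R V (7 + length ys)"
  shows "B a1 a5"
proof (rule ccontr)
  assume nB: "\<not> B a1 a5"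
  have V: "set [a0,a1,a2,a3,a4,a5,a6,a7] \<subseteq> V" "distinct (a0#a1#a2#a3#a4#a5#a6#a7#ys)"
    using cyc by (auto simp: is_cycle_def)
  have r15: "R a1 a5"
    using nB V unfolding B_def by auto
  have neg': "\<And>zs. length zs = 7 + length ys \<Longrightarrow> \<not> is_cycle R V zs"
    using neg by (auto simp: has_cycle_def)
  have "\<not> R a0 a2" using neg'[of "a0#a2#a3#a4#a5#a6#a7#ys"] cyc by (auto simp: is_cycle_def)
  moreover have "\<not> R a3 a5" using neg'[of "a0#a1#a2#a3#a5#a6#a7#ys"] cyc by (auto simp: is_cycle_def)
  moreover have "\<not> R a5 a7" using neg'[of "a0#a1#a2#a3#a4#a5#a7#ys"] cyc by (auto simp: is_cycle_def)
  moreover have "\<not> R a2 a7" using neg'[of "a0#a1#a5#a4#a3#a2#a7#ys"] cyc r15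
    by (auto simp: is_cycle_def R_commute)
  moreover have "\<not> R a0 a3" using neg'[of "a0#a3#a2#a1#a5#a6#a7#ys"] cyc r15
    by (auto simp: is_cycle_def R_commute)
  ultimately show False
    using blue_pentagon_False[OF no5, of a0 a2 a7 a5 a3] V unfolding B_def by (auto simp: R_commute)
qed

lemma nth_step_two_blue:
  assumes cyc: "is_cycle R V xs" and neg: "\<not> has_cycle R V (length xs - 1)" and len: "4 \<le> length xs"
  shows "B (xs ! (i mod length xs)) (xs ! ((i + 2) mod length xs))"
proof -
  let ?zs = "rotate i xs"
  have c: "is_cycle R V ?zs" and l: "length ?zs = length xs"
    using is_cycle_rotate[OF cyc] by auto
  have "Suc (Suc (Suc 0)) \<le> length ?zs"
    using len by simp
  then obtain a b c ys where zs: "?zs = a#b#c#ys"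
    by (metis Suc_le_length_iff)
  then have "length xs - 1 = Suc (Suc (length ys))"
    using l by (metis diff_Suc_1 length_Cons)
  then have "B a c"
    using step_two_blue c neg unfolding zs by metis
  moreover have "a = ?zs ! 0" "c = ?zs ! 2"
    by (auto simp: zs)
  ultimately show ?thesis
    using len nth_rotate[of 0 xs i] nth_rotate[of 2 xs i] by (cases "xs = []") (simp_all add: add.commute)
qed

lemma nth_step_four_blue:
  assumes no5: "\<not> has_cycle B V 5" and cyc: "is_cycle R V xs"
    and neg: "\<not> has_cycle R V (length xs - 1)" and len: "8 \<le> length xs"
  shows "B (xs ! ((i + 1) mod length xs)) (xs ! ((i + 5) mod length xs))"
proof -
  let ?zs = "rotate i xs"
  have c: "is_cycle R V ?zs" and l: "length ?zs = length xs"
    using is_cycle_rotate[OF cyc] by auto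
  have "Suc (Suc (Suc (Suc (Suc (Suc (Suc (Suc 0))))))) \<le> length ?zs"
    using len by simp
  then obtain a0 a1 a2 a3 a4 a5 a6 a7 ys where zs: "?zs = a0#a1#a2#a3#a4#a5#a6#a7#ys"
    by (metis Suc_le_length_iff)
  have "length xs - 1 = 7 + length ys"
    using l unfolding zs by simp
  then have "B a1 a5"
    using step_four_blue[OF no5] c neg unfolding zs by metis
  moreover have "a1 = ?zs ! 1" "a5 = ?zs ! 5"
    by (auto simp: zs)
  ultimately show ?thesis
    using len nth_rotate[of 1 xs i] nth_rotate[of 5 xs i] by (simp add: add.commute)
qed

text \<open>The indices 0, 4, 8, 6, 2 close up by the steps +4, +4, -2, -4, -2, all blue. They are
  distinct as soon as index 8 exists without wrapping, which is why length 8 needs separate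
  treatment.\<close>

lemma red_cycle_shorten_long:
  assumes no5: "\<not> has_cycle B V 5" and cyc: "is_cycle R V xs" and len: "length xs \<ge> 9"
  shows "has_cycle R V (length xs - 1)"
proof (rule ccontr)
  assume neg: "\<not> ?thesis"
  note four = nth_step_four_blue[OF no5 cyc neg]
  note two = nth_step_two_blue[OF cyc neg]
  have "distinct xs" "set xs \<subseteq> V" "xs \<noteq> []"
    using cyc by (auto simp: is_cycle_def)
  moreover have wrap: "length xs - 1 + 1 = length xs" "length xs - 1 + 5 = length xs + 4"
    using len by simp_all
  \<comment> \<open>\<open>four\<close> is shifted by one, so the chord starting at index 0 arises
    from the last index.\<close>
  moreover have "B (xs!0) (xs!4)"
    using four[of "length xs - 1"] wrap len by simp
  moreover have "B (xs!4) (xs!8)"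
    using four[of 3] len by simp
  moreover have "B (xs!8) (xs!6)"
    using two[of 6] len by (simp add: B_commute)
  moreover have "B (xs!6) (xs!2)"
    using four[of 1] len by (simp add: B_commute numeral_2_eq_2)
  moreover have "B (xs!2) (xs!0)"
    using two[of 0] len by (simp add: B_commute numeral_2_eq_2)
  ultimately show False
    using blue_pentagon_False[OF no5, of "xs!0" "xs!4" "xs!8" "xs!6" "xs!2"] len
    by (auto simp: nth_eq_iff_index_eq subset_iff)
qed

lemma red_heptagon_step_two:
  assumes cyc: "is_cycle R V [a0,a1,a2,a3,a4,a5,a6]" and no6: "\<not> has_cycle R V 6"
  shows "B a1 a3" "B a3 a5" "B a4 a6" "B a5 a0"
proof -
  have "\<not> has_cycle R V (length [a0,a1,a2,a3,a4,a5,a6] - 1)"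
    using no6 by (simp add: eval_nat_numeral)
  note two = nth_step_two_blue[OF cyc this]
  show "B a1 a3" "B a3 a5" "B a4 a6" "B a5 a0"
    using two[of 1] two[of 3] two[of 4] two[of 5] by simp_all
qed

text \<open>Consider the seven chords \<open>a_i a_(i+4)\<close>, with indices modulo 7. By
  \<open>chord\<close>, one of those for \<open>i\<close> and \<open>i+2\<close> is blue, so at
  least four are blue; by \<open>pent(2)\<close>, those for consecutive \<open>i\<close> are not
  both blue, so at most three are. The final \<open>argo\<close> call resolves this finite
  contradiction.\<close>

lemma red_heptagon_shorten:
  assumes no5: "\<not> has_cycle B V 5" and cyc: "is_cycle R V xs" and len: "length xs = 7"
  shows "has_cycle R V 6"
proof (rule ccontr)
  assume no6: "\<not> ?thesis"
  have "length xs = Suc (Suc (Suc (Suc (Suc (Suc (Suc 0))))))"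
    using len by simp
  then obtain a0 a1 a2 a3 a4 a5 a6 where xs: "xs = [a0,a1,a2,a3,a4,a5,a6]"
    by (auto simp: length_Suc_conv)
  have rot: "is_cycle R V [a0,a1,a2,a3,a4,a5,a6]" "is_cycle R V [a1,a2,a3,a4,a5,a6,a0]"
    "is_cycle R V [a2,a3,a4,a5,a6,a0,a1]" "is_cycle R V [a3,a4,a5,a6,a0,a1,a2]"
    "is_cycle R V [a4,a5,a6,a0,a1,a2,a3]" "is_cycle R V [a5,a6,a0,a1,a2,a3,a4]"
    "is_cycle R V [a6,a0,a1,a2,a3,a4,a5]"
    using cyc unfolding xs by (auto simp: is_cycle_def)
  \<comment> \<open>In the order of the blue heptagon \<open>a0 a2 a4 a6 a1 a3 a5\<close>, the chords \<open>a\<^sub>i a\<^sub>i\<^sub>+\<^sub>4\<close>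
    join vertices at distance two.\<close>
  have chord: "B b3 b0 \<or> B b1 b5" if "is_cycle R V [b0,b1,b2,b3,b4,b5,b6]" for b0 b1 b2 b3 b4 b5 b6
  proof (rule ccontr)
    assume "\<not> ?thesis"
    then have "is_cycle R V [b0,b3,b2,b1,b5,b6]"
      using that by (auto simp: is_cycle_def B_def R_commute)
    then show False using no6 by (auto simp: has_cycle_def)
  qed
  have pent: "\<not> (B b0 b4 \<and> B b4 b1)" "\<not> (B b0 b4 \<and> B b6 b3)"
    if "is_cycle R V [b0,b1,b2,b3,b4,b5,b6]" for b0 b1 b2 b3 b4 b5 b6
    using blue_pentagon_False[OF no5, of b0 b4 b1 b3 b5]
      blue_pentagon_False[OF no5, of b0 b4 b6 b3 b5]
      red_heptagon_step_two[OF that no6] that by (auto simp: is_cycle_def)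
  show False
    using rot[THEN chord] rot[THEN pent(1)] rot[THEN pent(2)] by argo
qed

section \<open>Red octagons, where a red K_4,4 blocks the shortening\<close>

lemma red_octagon_chords:
  assumes no5: "\<not> has_cycle B V 5" and no7: "\<not> has_cycle R V 7"
    and cyc: "is_cycle R V [a0,a1,a2,a3,a4,a5,a6,a7]"
  shows "B a0 a2" "B a0 a4" "R a0 a5 \<or> R a1 a6" "R a0 a5 \<or> R a1 a4"
proof -
  let ?xs = "[a0,a1,a2,a3,a4,a5,a6,a7]"
  have V: "distinct ?xs" "set ?xs \<subseteq> V"
    using cyc by (auto simp: is_cycle_def)
  have "\<not> has_cycle R V (length ?xs - 1)"
    using no7 by (simp add: eval_nat_numeral)
  note two' = nth_step_two_blue[OF cyc this] and four' = nth_step_four_blue[OF no5 cyc this]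
  have two: "B a0 a2" "B a1 a3" "B a3 a5" "B a2 a4" "B a4 a6"
    using two'[of 0] two'[of 1] two'[of 3] two'[of 2] two'[of 4] by simp_all
  have four: "B a0 a4" "B a1 a5" "B a2 a6"
    using four'[of 7] four'[of 0] four'[of 1] by simp_all
  show "B a0 a2" "B a0 a4" by fact+
  \<comment> \<open>Two such blue chords of length three would be linked by blue chords of lengths
    two and four into a pentagon; likewise in the next claim. In a red K_4,4 all chords of length
    three are red.\<close>
  show "R a0 a5 \<or> R a1 a6"
    using blue_pentagon_False[OF no5, of a0 a5 a1 a6 a2] V two four not_R_iff
    by (auto simp: B_commute)
  show "R a0 a5 \<or> R a1 a4"
    using blue_pentagon_False[OF no5, of a1 a4 a0 a5 a3] V two four not_R_iff
    by (auto simp: B_commute)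
qed

text \<open>A red edge from \<open>u\<close> to an odd position would close a red heptagon through
  \<open>u\<close>. For positions 3 and 5 it follows the octagon; for the neighbours 1 and 7 of
  \<open>a0\<close> it takes a red chord of length three as a shortcut, whence the rotated copy
  \<open>cyc'\<close>.\<close>

lemma red_octagon_no_outside_nbrs:
  assumes no5: "\<not> has_cycle B V 5" and no7: "\<not> has_cycle R V 7"
    and cyc: "is_cycle R V [a0,a1,a2,a3,a4,a5,a6,a7]"
    and u: "u \<in> V" "u \<notin> set [a0,a1,a2,a3,a4,a5,a6,a7]" "R u a0"
  shows "B u a1 \<and> B u a3 \<and> B u a5 \<and> B u a7"
proof -
  note chords = red_octagon_chords[OF no5 no7 cyc]
  have cyc': "is_cycle R V [a7,a0,a1,a2,a3,a4,a5,a6]"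
    using cyc by (auto simp: is_cycle_def)
  note chords' = red_octagon_chords[OF no5 no7 cyc']
  have "\<not> R u a1"
    using chords(4) no7 cyc u has_cycleI[of R V "[u,a1,a2,a3,a4,a5,a0]" 7]
      has_cycleI[of R V "[u,a1,a4,a5,a6,a7,a0]" 7]
    by (auto simp: is_cycle_def R_commute)
  moreover have "\<not> R u a3"
    using no7 cyc u has_cycleI[of R V "[u,a3,a4,a5,a6,a7,a0]" 7]
    by (auto simp: is_cycle_def R_commute)
  moreover have "\<not> R u a5"
    using no7 cyc u has_cycleI[of R V "[u,a5,a4,a3,a2,a1,a0]" 7]
    by (auto simp: is_cycle_def R_commute)
  moreover have "\<not> R u a7"
    using chords'(4) no7 cyc u has_cycleI[of R V "[u,a0,a1,a2,a3,a4,a7]" 7]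
      has_cycleI[of R V "[u,a0,a3,a4,a5,a6,a7]" 7]
    by (auto simp: is_cycle_def R_commute)
  ultimately show ?thesis
    using u unfolding B_def by auto
qed

text \<open>A red K_4,4 has no red heptagon, and its blue graph, two copies of K_4, has no pentagon;
  so a ninth vertex \<open>u\<close> must enter. It is blue to all octagon vertices of one parity,
  and these carry a blue path on four vertices that closes to a pentagon through
  \<open>u\<close>.\<close>

lemma red_octagon_heptagon:
  assumes no5: "\<not> has_cycle B V 5" and cyc: "is_cycle R V xs" and len: "length xs = 8"
    and card: "card V \<ge> 9"
  shows "has_cycle R V 7"
proof (rule ccontr)
  assume no7: "\<not> ?thesis"
  have "length xs = Suc (Suc (Suc (Suc (Suc (Suc (Suc (Suc 0)))))))"
    using len by simp
  then obtain a0 a1 a2 a3 a4 a5 a6 a7 where xs: "xs = [a0,a1,a2,a3,a4,a5,a6,a7]"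
    by (auto simp: length_Suc_conv)
  have V: "distinct xs" "set xs \<subseteq> V"
    using cyc by (auto simp: is_cycle_def)
  then have "card (set xs) < card V"
    using card len by (simp add: distinct_card)
  then obtain u where u: "u \<in> V" "u \<notin> set xs"
    by (metis card_mono finite_set leD subsetI)
  have rot: "is_cycle R V [a0,a1,a2,a3,a4,a5,a6,a7]" "is_cycle R V [a1,a2,a3,a4,a5,a6,a7,a0]"
    "is_cycle R V [a2,a3,a4,a5,a6,a7,a0,a1]" "is_cycle R V [a3,a4,a5,a6,a7,a0,a1,a2]"
    "is_cycle R V [a4,a5,a6,a7,a0,a1,a2,a3]" "is_cycle R V [a5,a6,a7,a0,a1,a2,a3,a4]"
    "is_cycle R V [a6,a7,a0,a1,a2,a3,a4,a5]" "is_cycle R V [a7,a0,a1,a2,a3,a4,a5,a6]"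
    using cyc unfolding xs by (auto simp: is_cycle_def)
  have blue: "B a0 a2" "B a1 a3" "B a2 a4" "B a3 a5" "B a4 a6" "B a5 a7" "B a0 a4" "B a1 a5"
    "B a2 a6" "B a3 a7"
    using rot[THEN red_octagon_chords(1)[OF no5 no7]] rot[THEN red_octagon_chords(2)[OF no5 no7]]
    by blast+
  have nbr: "R u b0 \<longrightarrow> B u b1 \<and> B u b3 \<and> B u b5 \<and> B u b7"
    if "is_cycle R V [b0,b1,b2,b3,b4,b5,b6,b7]" "set [b0,b1,b2,b3,b4,b5,b6,b7] = set xs"
    for b0 b1 b2 b3 b4 b5 b6 b7
    using red_octagon_no_outside_nbrs[OF no5 no7 that(1), of u] u that(2) by blast
  have "B u a1 \<and> B u a3 \<and> B u a5 \<and> B u a7 \<or> B u a0 \<and> B u a2 \<and> B u a4 \<and> B u a6"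
    using nbr[OF rot(1)] nbr[OF rot(3)] nbr[OF rot(5)] nbr[OF rot(7)] u
    unfolding B_def xs by auto
  then show False
    using blue_pentagon_False[OF no5, of u a1 a5 a3 a7] blue_pentagon_False[OF no5, of u a0 a4 a2 a6]
      V u blue B_commute unfolding xs by auto
qed

text \<open>This is for \<open>n = 6\<close>, where the octagon may cover the whole graph: a red
  chord of length three closes a hexagon at once.\<close>

lemma red_octagon_hexagon:
  assumes no5: "\<not> has_cycle B V 5" and cyc: "is_cycle R V xs" and len: "length xs = 8"
  shows "has_cycle R V 7 \<or> has_cycle R V 6"
proof (rule ccontr)
  assume no: "\<not> ?thesis"
  have "length xs = Suc (Suc (Suc (Suc (Suc (Suc (Suc (Suc 0)))))))"
    using len by simp
  then obtain a0 a1 a2 a3 a4 a5 a6 a7 where xs: "xs = [a0,a1,a2,a3,a4,a5,a6,a7]"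
    by (auto simp: length_Suc_conv)
  have "R a0 a5 \<or> R a1 a6"
    using red_octagon_chords(3) no5 no cyc unfolding xs by blast
  then show False
    using cyc no has_cycleI[of R V "[a0,a1,a2,a3,a4,a5]" 6] has_cycleI[of R V "[a1,a2,a3,a4,a5,a6]" 6]
    by (auto simp: xs is_cycle_def R_commute)
qed

section \<open>Descent from a long red cycle to length n\<close>

lemma red_cycle_descend_triangle:
  assumes no3: "\<not> has_cycle B V 3" and n: "n \<ge> 5"
  shows "is_cycle R V xs \<Longrightarrow> n \<le> length xs \<Longrightarrow> has_cycle R V n"
proof (induction "length xs" arbitrary: xs rule: less_induct)
  case less
  show ?case
  proof (cases "length xs = n")
    case True
    then show ?thesis using less.prems has_cycleI by blast
  next
    case False
    then have "has_cycle R V (length xs - 1)"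
      using red_cycle_shorten[OF no3 less.prems(1)] less.prems(2) n by simp
    then obtain ys where "is_cycle R V ys" "length ys = length xs - 1"
      by (auto simp: has_cycle_def)
    then show ?thesis
      using less.hyps[of ys] less.prems(2) False n by simp
  qed
qed

lemma red_cycle_descend_pentagon:
  assumes no5: "\<not> has_cycle B V 5" and n: "n \<ge> 6" and card: "card V \<ge> n + 2"
  shows "is_cycle R V xs \<Longrightarrow> n \<le> length xs \<Longrightarrow> has_cycle R V n"
proof (induction "length xs" arbitrary: xs rule: less_induct)
  case less
  \<comment> \<open>The length drops by one, except that for \<open>n = 6\<close> an octagon may
    jump straight to a hexagon. For \<open>n = 7\<close> the bound on \<open>card V\<close> supplies
    the ninth vertex.\<close>
  consider "length xs = n" | "length xs = 8" "n = 6" "has_cycle R V 6" |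
    "n < length xs" "has_cycle R V (length xs - 1)"
  proof -
    have False if "n \<noteq> length xs" "\<not> (length xs = 8 \<and> n = 6 \<and> has_cycle R V 6)"
      "\<not> has_cycle R V (length xs - 1)"
    proof -
      have "length xs = 7 \<or> length xs = 8 \<or> length xs \<ge> 9"
        using n less.prems(2) that(1) by linarith
      then show False
        using red_heptagon_shorten[OF no5 less.prems(1)] red_octagon_heptagon[OF no5 less.prems(1)]
          red_octagon_hexagon[OF no5 less.prems(1)] red_cycle_shorten_long[OF no5 less.prems(1)]
          that n card less.prems(2) by auto
    qed
    then show thesis
      using that less.prems(2) by fastforce
  qed
  then show ?case
  proof cases
    case 1
    then show ?thesis using less.prems has_cycleI by blast
  next
    case 3
    then obtain ys where "is_cycle R V ys" "length ys = length xs - 1"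
      by (auto simp: has_cycle_def)
    then show ?thesis
      using less.hyps[of ys] 3(1) by simp
  qed simp
qed

end

section \<open>Longest red cycles\<close>

lemma longest_cycleD: "longest_cycle E V xs \<Longrightarrow> is_cycle E V ys \<Longrightarrow> length ys \<le> length xs"
  unfolding longest_cycle_def by blast

lemma longest_cycle_cong_length:
  "longest_cycle E V xs \<Longrightarrow> is_cycle E V ys \<Longrightarrow> length ys = length xs \<Longrightarrow> longest_cycle E V ys"
  unfolding longest_cycle_def by simp

lemma longest_cycle_append_commute:
  "longest_cycle E V (xs @ ys) \<Longrightarrow> longest_cycle E V (ys @ xs)"
  using is_cycle_append_commute longest_cycle_cong_length
  by (metis add.commute length_append longest_cycle_def)

context red_blue_relation
begin

text \<open>Each violation would produce a longer cycle. Here \<open>hd ys\<close> and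
  \<open>hd zs\<close> are the successors of \<open>a\<close> and \<open>b\<close>, and
  \<open>last zs\<close> and \<open>last ys\<close> their predecessors. Inserting \<open>u\<close>
  next to \<open>a\<close> or \<open>b\<close> gives the blue edges at \<open>u\<close>; a red edge
  between the successors, or between the predecessors, lets the cycle traverse one arc backwards and
  pick up \<open>u\<close>; a path through \<open>w\<close> in place of a forbidden edge gains one
  vertex more.\<close>

lemma longest_cycle_two_nbrs:
  assumes long: "longest_cycle R V (a # ys @ b # zs)"
    and u: "u \<in> V" "u \<notin> set (a # ys @ b # zs)" "R u a" "R u b"
  shows "ys \<noteq> []" "zs \<noteq> []"
    "\<And>v. v \<in> {hd ys, last ys, hd zs, last zs} \<Longrightarrow> B u v"
    "B (hd ys) (hd zs)" "B (last ys) (last zs)"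
    "\<And>w. w \<in> V \<Longrightarrow> w \<notin> set (u # a # ys @ b # zs) \<Longrightarrow> \<not> (R w (hd ys) \<and> R w (hd zs))"
    "\<And>w. w \<in> V \<Longrightarrow> w \<notin> set (u # a # ys @ b # zs) \<Longrightarrow> \<not> (R w (last ys) \<and> R w (last zs))"
    "\<And>w v. w \<in> V \<Longrightarrow> w \<notin> set (u # a # ys @ b # zs) \<Longrightarrow> v \<in> {hd ys, last ys, hd zs, last zs} \<Longrightarrow>
      \<not> (R u w \<and> R w v)"
proof -
  note defs = is_cycle_def successively_append_iff successively_Cons hd_append last_append
    hd_rev last_rev successively_rev_sym[OF symp_R] R_commute
  have cyc: "is_cycle R V (a # ys @ b # zs)"
    using long by (simp add: longest_cycle_def)
  have no: "\<not> is_cycle R V vs" if "length vs > 2 + length ys + length zs" for vs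
    using longest_cycleD[OF long, of vs] that by auto
  show ys: "ys \<noteq> []"
    using cyc u no[of "a # u # b # zs"] by (auto simp: defs)
  show zs: "zs \<noteq> []"
    using cyc u ys no[of "b # u # a # ys"] by (auto simp: defs)
  note ne = ys zs
  have V: "hd ys \<in> set ys" "last ys \<in> set ys" "hd zs \<in> set zs" "last zs \<in> set zs"
    using ne by auto
  have neq: "u \<noteq> hd ys" "u \<noteq> last ys" "u \<noteq> hd zs" "u \<noteq> last zs" "hd ys \<noteq> hd zs" "last ys \<noteq> last zs"
    using V u cyc by (auto simp: is_cycle_def)
  have "\<not> R u (hd ys)" using cyc u ne no[of "a # u # ys @ b # zs"] by (auto simp: defs)
  moreover have "\<not> R u (last ys)" using cyc u ne no[of "a # ys @ u # b # zs"] by (auto simp: defs)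
  moreover have "\<not> R u (hd zs)" using cyc u ne no[of "a # ys @ b # u # zs"] by (auto simp: defs)
  moreover have "\<not> R u (last zs)" using cyc u ne no[of "u # a # ys @ b # zs"] by (auto simp: defs)
  ultimately show "B u v" if "v \<in> {hd ys, last ys, hd zs, last zs}" for v
    using that neq unfolding B_def by auto
  show "B (hd ys) (hd zs)"
    using cyc u ne neq no[of "a # u # b # rev ys @ zs"] by (auto simp: defs B_def)
  show "B (last ys) (last zs)"
    using cyc u ne neq no[of "a # ys @ rev zs @ [b, u]"] by (auto simp: defs B_def)
  show "\<not> (R w (hd ys) \<and> R w (hd zs))" if "w \<in> V" "w \<notin> set (u # a # ys @ b # zs)" for w
    using cyc u ne neq that no[of "a # u # b # rev ys @ w # zs"] by (auto simp: defs B_def)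
  show "\<not> (R w (last ys) \<and> R w (last zs))" if "w \<in> V" "w \<notin> set (u # a # ys @ b # zs)" for w
    using cyc u ne neq that no[of "a # ys @ w # rev zs @ [b, u]"] by (auto simp: defs B_def)
  show "\<not> (R u w \<and> R w v)" if "w \<in> V" "w \<notin> set (u # a # ys @ b # zs)"
    "v \<in> {hd ys, last ys, hd zs, last zs}" for w v
    using cyc u ne neq that no[of "a # u # w # ys @ b # zs"] no[of "a # ys @ w # u # b # zs"]
      no[of "a # ys @ b # u # w # zs"] no[of "w # u # a # ys @ b # zs"] by (auto simp: defs B_def)
qed

lemma longest_cycle_split:
  assumes long: "longest_cycle R V xs" and "a \<in> set xs" "b \<in> set xs" "a \<noteq> b"
  obtains ys zs where "longest_cycle R V (a # ys @ b # zs)" "set (a # ys @ b # zs) = set xs"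
  using is_cycle_Cons_Cons_obtain assms longest_cycle_cong_length longest_cycle_def
  by metis

text \<open>With both arcs this long, the cycle neighbours \<open>p\<close>, \<open>q\<close>,
  \<open>r\<close>, \<open>s\<close> of \<open>a\<close> and \<open>b\<close> are distinct. If
  \<open>w\<close> were blue to one of \<open>p\<close>, \<open>r\<close> and to one of
  \<open>q\<close>, \<open>s\<close>, a blue pentagon through \<open>u\<close> and \<open>w\<close>
  would arise; so \<open>w\<close> is red to both vertices of one pair, against the maximality of
  the cycle.\<close>

lemma longest_cycle_nbrs_far_False:
  assumes no5: "\<not> has_cycle B V 5" and long: "longest_cycle R V (a # ys @ b # zs)"
    and u: "u \<in> V" "u \<notin> set (a # ys @ b # zs)" "R u a" "R u b"
    and w: "w \<in> V" "w \<notin> set (u # a # ys @ b # zs)"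
    and far: "length ys \<ge> 2" "length zs \<ge> 2"
  shows False
proof -
  note two = longest_cycle_two_nbrs[OF long u]
  obtain p ys' where "ys = p # ys'" "ys' \<noteq> []"
    using far(1) by (cases ys; cases "tl ys") auto
  then have ys: "hd ys \<noteq> last ys" "hd ys \<in> set ys" "last ys \<in> set ys"
    using long by (auto simp: longest_cycle_def is_cycle_def)
  obtain r zs' where "zs = r # zs'" "zs' \<noteq> []"
    using far(2) by (cases zs; cases "tl zs") auto
  then have zs: "hd zs \<noteq> last zs" "hd zs \<in> set zs" "last zs \<in> set zs"
    using long by (auto simp: longest_cycle_def is_cycle_def)
  define p q r s where d: "p = hd ys" "q = last ys" "r = hd zs" "s = last zs"
  have dist: "distinct [u,w,p,q,r,s]" "set [u,w,p,q,r,s] \<subseteq> V"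
    using long ys zs u w unfolding d longest_cycle_def is_cycle_def by auto
  have blue: "B u p" "B u q" "B u r" "B u s" "B p r" "B q s"
    using two(3-5) unfolding d by auto
  have "\<not> (B w p \<and> B w q)" "\<not> (B w p \<and> B w s)" "\<not> (B w r \<and> B w q)" "\<not> (B w r \<and> B w s)"
    using blue_pentagon_False[OF no5, of u r p w q] blue_pentagon_False[OF no5, of u r p w s]
      blue_pentagon_False[OF no5, of u p r w q] blue_pentagon_False[OF no5, of u p r w s]
      dist blue B_commute by auto
  moreover have "\<not> (R w p \<and> R w r)" "\<not> (R w q \<and> R w s)"
    using two(6,7)[OF w] unfolding d by auto
  ultimately show False
    using dist unfolding B_def by auto
qed

text \<open>Among \<open>u\<close>, \<open>z\<close>, \<open>r\<close>, \<open>s\<close> all pairs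
  except possibly \<open>r s\<close> are blue. If \<open>w\<close> were blue to \<open>r\<close> or
  \<open>s\<close>, the pentagons would make \<open>w u\<close> and \<open>w z\<close> red, and the
  red path \<open>u w z\<close> would extend the cycle.\<close>

lemma longest_cycle_nbrs_distance_two:
  assumes no5: "\<not> has_cycle B V 5" and long: "longest_cycle R V (a # z # b # zs)"
    and u: "u \<in> V" "u \<notin> set (a # z # b # zs)" "R u a" "R u b"
    and w: "w \<in> V" "w \<notin> set (u # a # z # b # zs)"
    and far: "length zs \<ge> 2"
  shows "R w (hd zs)" "R w (last zs)"
proof -
  have long': "longest_cycle R V (a # [z] @ b # zs)"
    using long by simp
  have u': "u \<notin> set (a # [z] @ b # zs)" and w': "w \<notin> set (u # a # [z] @ b # zs)"
    using u w by auto
  note two = longest_cycle_two_nbrs[OF long' u(1) u' u(3,4)]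
  obtain r' zs' where "zs = r' # zs'" "zs' \<noteq> []"
    using far by (cases zs; cases "tl zs") auto
  then have zs: "hd zs \<noteq> last zs" "hd zs \<in> set zs" "last zs \<in> set zs"
    using long by (auto simp: longest_cycle_def is_cycle_def)
  define r s where d: "r = hd zs" "s = last zs"
  have dist: "distinct [u,w,z,r,s]" "set [u,w,z,r,s] \<subseteq> V"
    using long zs u w unfolding d longest_cycle_def is_cycle_def by auto
  have blue: "B u z" "B u r" "B u s" "B z r" "B z s"
    using two(3-5) unfolding d by auto
  have "\<not> (B w s \<and> B w r)" "\<not> (B w z \<and> B w r)" "\<not> (B w z \<and> B w s)"
     "\<not> (B w u \<and> B w r)" "\<not> (B w u \<and> B w s)"
    using blue_pentagon_False[OF no5, of s w r u z] blue_pentagon_False[OF no5, of z w r u s]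
      blue_pentagon_False[OF no5, of z w s u r] blue_pentagon_False[OF no5, of u w r z s]
      blue_pentagon_False[OF no5, of u w s z r] dist blue B_commute by auto
  moreover have "\<not> (R u w \<and> R w z)"
    using two(8)[OF w(1) w', of z] by auto
  ultimately have "\<not> B w r" "\<not> B w s"
    using dist R_commute unfolding B_def by auto
  then show "R w (hd zs)" "R w (last zs)"
    using dist unfolding B_def d by auto
qed

text \<open>This is the configuration left by a longest red cycle of length four. The first claim
  comes from the red hexagon \<open>a x w y b z\<close>, the second from the blue pentagon
  \<open>x w y z w'\<close>. In the third, excluding red pentagons makes \<open>w a\<close> and
  \<open>w' a\<close> blue, which leaves the blue pentagon \<open>x w a w' y\<close>.\<close>

lemma blue_triangle_red_joined:
  assumes no5: "\<not> has_cycle B V 5" and no: "\<And>vs. length vs > 4 \<Longrightarrow> \<not> is_cycle R V vs"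
    and V: "distinct [x,y,z,w,w',a,b]" "set [x,y,z,w,w',a,b] \<subseteq> V"
    and blue: "B x y" "B y z" "B x z"
    and red: "R x a" "R x b" "R y a" "R y b" "R z a" "R z b"
  shows "\<not> (R w x \<and> R w y)" "\<not> (B w x \<and> B w y \<and> B w' x \<and> B w' z)"
    "\<not> (R w z \<and> R w' z \<and> B w x \<and> B w y \<and> B w' x \<and> B w' y)"
proof -
  show "\<not> (R w x \<and> R w y)"
    using no[of "[a, x, w, y, b, z]"] V red by (auto simp: is_cycle_def R_commute)
  show "\<not> (B w x \<and> B w y \<and> B w' x \<and> B w' z)"
    using blue_pentagon_False[OF no5, of x w y z w'] V blue B_commute by auto
  show "\<not> (R w z \<and> R w' z \<and> B w x \<and> B w y \<and> B w' x \<and> B w' y)"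
  proof
    assume *: "R w z \<and> R w' z \<and> B w x \<and> B w y \<and> B w' x \<and> B w' y"
    then have "\<not> R w a" "\<not> R w' a"
      using no[of "[a, w, z, b, x]"] no[of "[a, w', z, b, x]"] V red
      by (auto simp: is_cycle_def R_commute)
    then show False
      using blue_pentagon_False[OF no5, of x w a w' y] V blue * unfolding B_def
      by (auto simp: R_commute)
  qed
qed

text \<open>Two red neighbours \<open>a\<close>, \<open>b\<close> cut the cycle into two arcs. By
  \<open>short\<close>, an arc opposite a long one is a single vertex; \<open>long_arc\<close> then
  excludes long arcs altogether. Two single-vertex arcs leave a red 4-cycle, refuted with two
  further outside vertices \<open>w\<close> and \<open>w'\<close>.\<close>

lemma longest_cycle_outside_one_nbr:
  assumes no5: "\<not> has_cycle B V 5" and long: "longest_cycle R V xs"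
    and card: "card (V - set xs) \<ge> 3"
    and u: "u \<in> V - set xs" and ab: "a \<in> set xs" "b \<in> set xs" "R u a" "R u b"
  shows "a = b"
proof (rule ccontr)
  assume "a \<noteq> b"
  then obtain ys zs where long': "longest_cycle R V (a # ys @ b # zs)"
    and set: "set (a # ys @ b # zs) = set xs"
    using longest_cycle_split long ab by metis
  have "card (V - set xs - {u}) \<ge> 2"
    using card u by (simp add: card_Diff_singleton)
  then obtain w w' where "w \<in> V - set xs - {u}" "w' \<in> V - set xs - {u}" "w \<noteq> w'"
    by (meson card_2_iff' obtain_subset_with_card_n subsetD)
  then have w: "w \<in> V" "w \<notin> set xs" "w \<noteq> u" "w' \<in> V" "w' \<notin> set xs" "w' \<noteq> u" "w \<noteq> w'"
    by auto
  have u': "u \<in> V" "u \<notin> set xs"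
    using u by auto
  have short: "\<exists>z. ys = [z]" if "longest_cycle R V (a # ys @ b # zs)"
    "set (a # ys @ b # zs) = set xs" "length zs \<ge> 2" "v \<in> V" "v \<notin> set xs" "R v a" "R v b"
    "v' \<in> V" "v' \<notin> set xs" "v' \<noteq> v" for a b ys zs v v'
  proof -
    have "ys \<noteq> []"
      using longest_cycle_two_nbrs(1)[OF that(1), of v] that by metis
    moreover have "\<not> length ys \<ge> 2"
      using longest_cycle_nbrs_far_False[OF no5 that(1), of v v'] that by auto
    ultimately show ?thesis
      by (cases ys; cases "tl ys") auto
  qed
  \<comment> \<open>Every outside vertex other than \<open>u\<close> is red to both ends
    \<open>t\<close>, \<open>s\<close> of \<open>zs\<close>. The same analysis for \<open>w\<close>
    with its neighbours \<open>t\<close> and \<open>s\<close>, whose other arc \<open>a z b\<close>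
    is long, makes \<open>w'\<close> red to \<open>a\<close>. But \<open>w'\<close> is also red to
    \<open>s\<close>, the vertex next to \<open>a\<close> on the cycle.\<close>
  have long_arc: False if L: "longest_cycle R V (a # [z] @ b # zs)" "set (a # [z] @ b # zs) = set xs"
    and len: "length zs \<ge> 2" and "R u a" "R u b" for a b z zs
  proof -
    have L': "longest_cycle R V (a # z # b # zs)" and set': "set (a # z # b # zs) = set xs"
      using L by auto
    have r: "R v (hd zs)" "R v (last zs)" if "v \<in> V" "v \<notin> set xs" "v \<noteq> u" for v
      using longest_cycle_nbrs_distance_two[OF no5 L', of u v] that u' set' len \<open>R u a\<close> \<open>R u b\<close>
      by auto
    obtain t ts where t: "zs = t # ts" "ts \<noteq> []"
      using len by (cases zs; cases "tl zs") auto
    then obtain m s where zs: "zs = t # m @ [s]"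
      by (metis rev_exhaust)
    have "longest_cycle R V ([a, z, b] @ t # m @ [s])"
      using L' zs by simp
    then have "longest_cycle R V ((t # m @ [s]) @ [a, z, b])"
      by (rule longest_cycle_append_commute)
    then have L2: "longest_cycle R V (t # m @ s # [a, z, b])"
      by simp
    have set2: "set (t # m @ s # [a, z, b]) = set xs"
      using set' zs by auto
    have "\<exists>x. m = [x]"
      using short[OF L2 set2, of w w'] r w zs by simp
    then obtain x where "m = [x]" by blast
    then have L3: "longest_cycle R V (t # x # s # [a, z, b])"
      and set3: "set (t # x # s # [a, z, b]) = set xs"
      using L2 set2 by auto
    have "R w' a" "R w' t"
      using longest_cycle_nbrs_distance_two[OF no5 L3, of w w'] r w zs set3 by auto
    moreover have "R w' s"
      using r w zs by auto
    moreover have "longest_cycle R V (s # [] @ a # [z, b, t, x])"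
      using longest_cycle_append_commute[of R V "[t, x]" "[s, a, z, b]"] L3 by simp
    ultimately show False
      using longest_cycle_two_nbrs(1)[of s "[]" a "[z, b, t, x]" w'] w set3 by auto
  qed
  have set_sym: "set (b # zs @ a # ys) = set xs"
    using set by auto
  have long_sym: "longest_cycle R V (b # zs @ a # ys)"
    using longest_cycle_append_commute[of R V "a # ys" "b # zs"] long' by simp
  have ne: "ys \<noteq> []" "zs \<noteq> []"
    using longest_cycle_two_nbrs(1,2)[OF long', of u] u' ab set by auto
  have "\<not> length zs \<ge> 2"
  proof
    assume len: "length zs \<ge> 2"
    then obtain z where "ys = [z]"
      using short[OF long' set len, of u w] u' w ab by blast
    then show False
      using long_arc len long' set ab by blast
  qed
  moreover have "\<not> length ys \<ge> 2"
  proof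
    assume len: "length ys \<ge> 2"
    then obtain z where "zs = [z]"
      using short[OF long_sym set_sym len, of u w] u' w ab by blast
    then show False
      using long_arc len long_sym set_sym ab by blast
  qed
  ultimately obtain p q where pq: "ys = [p]" "zs = [q]"
    using ne by (cases ys; cases zs) (auto simp: not_less_eq_eq)
  have L: "longest_cycle R V [a, p, b, q]" and S: "set [a, p, b, q] = set xs"
    using long' set pq by auto
  have no: "\<not> is_cycle R V vs" if "length vs > 4" for vs
    using longest_cycleD[OF L, of vs] that by auto
  have cyc: "is_cycle R V [a, p, b, q]"
    using L by (simp add: longest_cycle_def)
  have out: "u \<notin> set [a, p, b, q]" "w \<notin> set [a, p, b, q]" "w' \<notin> set [a, p, b, q]"
    unfolding S using w u' by auto
  have V: "distinct [u,w,w',a,p,b,q]" "set [u,w,w',a,p,b,q] \<subseteq> V"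
    using cyc w(1,3,4,6,7) u'(1) out by (auto simp: is_cycle_def)
  note two = longest_cycle_two_nbrs[OF long', of u]
  have blue: "B u p" "B u q" "B p q"
    using two(3,4) pq u' set ab by auto
  \<comment> \<open>The vertex \<open>u\<close> can replace \<open>p\<close> or \<open>q\<close> in the cycle, so these three play the same role.\<close>
  have red: "R u a" "R u b" "R p a" "R p b" "R q a" "R q b"
    using cyc ab by (auto simp: is_cycle_def R_commute)
  have tri: "\<not> (R v x \<and> R v y)" "\<not> (B v x \<and> B v y \<and> B v' x \<and> B v' z)"
    "\<not> (R v z \<and> R v' z \<and> B v x \<and> B v y \<and> B v' x \<and> B v' y)"
    if "distinct [x, y, z]" "set [x, y, z] = {u, p, q}" "set [v, v'] = {w, w'}" for x y z v v'
  proof -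
    have "x \<in> {u, p, q}" "y \<in> {u, p, q}" "z \<in> {u, p, q}" "distinct [v, v']"
      "v \<in> {w, w'}" "v' \<in> {w, w'}"
      using that V(1) by (auto simp: doubleton_eq_iff)
    moreover from this have "distinct [x, y, z, v, v', a, b]" "set [x, y, z, v, v', a, b] \<subseteq> V"
      using that(1) V by auto
    moreover have "B x y" "B y z" "B x z"
      using calculation(1-3) that(1) blue B_commute by auto
    moreover have "R x a" "R x b" "R y a" "R y b" "R z a" "R z b"
      using calculation(1-3) red by auto
    ultimately show "\<not> (R v x \<and> R v y)" "\<not> (B v x \<and> B v y \<and> B v' x \<and> B v' z)"
      "\<not> (R v z \<and> R v' z \<and> B v x \<and> B v y \<and> B v' x \<and> B v' y)"
      using blue_triangle_red_joined[OF no5 no, of x y z v v' a b] by blast+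
  qed
  have dist: "distinct [u, p, q]" "distinct [p, q, u]" "distinct [q, u, p]"
    using V by auto
  have perms: "set [u, p, q] = {u, p, q}" "set [p, q, u] = {u, p, q}" "set [q, u, p] = {u, p, q}"
    "set [w, w'] = {w, w'}" "set [w', w] = {w, w'}"
    by auto
  have "B v x \<longleftrightarrow> \<not> R v x" if "v \<in> {w, w'}" "x \<in> {u, p, q}" for v x
    using that V unfolding B_def by auto
  then have "B w u \<longleftrightarrow> \<not> R w u" "B w p \<longleftrightarrow> \<not> R w p" "B w q \<longleftrightarrow> \<not> R w q"
    "B w' u \<longleftrightarrow> \<not> R w' u" "B w' p \<longleftrightarrow> \<not> R w' p" "B w' q \<longleftrightarrow> \<not> R w' q"
    by auto
  \<comment> \<open>By the first claim \<open>w\<close> and \<open>w'\<close> are each red to at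
    most one of \<open>u\<close>, \<open>p\<close>, \<open>q\<close>. The second excludes that one
    of them is red to none of these or that their red neighbours differ; the third excludes a common
    red neighbour.\<close>
  then show False
    using tri[OF dist(1) perms(1,4)] tri[OF dist(2) perms(2,4)] tri[OF dist(3) perms(3,4)]
      tri(1)[OF dist(1) perms(1,5)] tri(1)[OF dist(2) perms(2,5)] tri(1)[OF dist(3) perms(3,5)]
      tri(2)[OF dist(1) perms(1,5)] tri(2)[OF dist(2) perms(2,5)] tri(2)[OF dist(3) perms(3,5)]
    by argo
qed

end

section \<open>Two red cliques\<close>

lemma obtain_two_distinct:
  assumes "2 \<le> card A"
  obtains a b where "a \<in> A" "b \<in> A" "a \<noteq> b"
proof -
  obtain S where "S \<subseteq> A" "card S = 2"
    using obtain_subset_with_card_n[OF assms] by auto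
  then show thesis
    using that by (auto simp: card_2_iff)
qed

lemma obtain_three_distinct:
  assumes "3 \<le> card A"
  obtains a b c where "a \<in> A" "b \<in> A" "c \<in> A" "distinct [a, b, c]"
proof -
  obtain S where "S \<subseteq> A" "card S = 3"
    using obtain_subset_with_card_n[OF assms] by auto
  then show thesis
    using that by (auto simp: card_3_iff)
qed

context red_blue_relation
begin

definition red_clique :: "'a set \<Rightarrow> bool" where
  "red_clique S \<longleftrightarrow> (\<forall>a\<in>S. \<forall>b\<in>S. a \<noteq> b \<longrightarrow> R a b)"

lemma red_cliqueD: "red_clique S \<Longrightarrow> a \<in> S \<Longrightarrow> b \<in> S \<Longrightarrow> a \<noteq> b \<Longrightarrow> R a b"
  unfolding red_clique_def by blast

lemma red_clique_successively:
  "red_clique S \<Longrightarrow> set xs \<subseteq> S \<Longrightarrow> distinct xs \<Longrightarrow> successively R xs"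
proof (induction xs)
  case (Cons a xs)
  then show ?case
    by (cases xs) (auto simp: red_clique_def)
qed simp

lemma red_clique_is_cycle:
  assumes "red_clique S" "S \<subseteq> V" "set xs \<subseteq> S" "distinct xs" "length xs \<ge> 2"
  shows "is_cycle R V xs"
proof -
  obtain a ys where xs: "xs = a # ys" "ys \<noteq> []"
    using assms(5) by (cases xs; cases "tl xs") auto
  then have "last xs \<noteq> hd xs" "last xs \<in> S" "hd xs \<in> S"
    using assms(3,4) by (auto dest: last_in_set)
  then show ?thesis
    using assms red_clique_successively[OF assms(1,3,4)] xs
    by (auto simp: is_cycle_def red_clique_def)
qed

lemma red_clique_has_cycle:
  assumes "red_clique S" "S \<subseteq> V" "m \<le> card S" "m \<ge> 2"
  shows "has_cycle R V m"
proof -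
  obtain xs where "distinct xs" "set xs \<subseteq> S" "length xs = m"
    using distinct_list_obtain assms finite_subset[OF _ finite_V] by metis
  then show ?thesis
    using red_clique_is_cycle[OF assms(1,2), of xs] assms(4) has_cycleI by blast
qed

text \<open>This serves to refute the absence of red cycles longer than three. At least five
  vertices remain outside the triple; if they do not form a red clique, take a blue edge
  \<open>u u'\<close>. For every other outside vertex it forces a common red neighbour of
  \<open>u\<close> and \<open>u'\<close> that is blue to that vertex, and two such vertices complete
  the blue pentagon \<open>u u' w x w'\<close>.\<close>

lemma three_vertices_red_pentagon:
  assumes no5: "\<not> has_cycle B V 5" and card: "card V \<ge> 8"
    and C: "distinct [a, b, c]" "{a, b, c} \<subseteq> V"
    and one: "\<And>u x y. u \<in> V - {a, b, c} \<Longrightarrow> x \<in> {a, b, c} \<Longrightarrow> y \<in> {a, b, c} \<Longrightarrow> x \<noteq> y \<Longrightarrow>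
      \<not> (R u x \<and> R u y)"
    and diff: "\<And>u w x y. u \<in> V - {a, b, c} \<Longrightarrow> w \<in> V - {a, b, c} \<Longrightarrow> u \<noteq> w \<Longrightarrow>
      x \<in> {a, b, c} \<Longrightarrow> y \<in> {a, b, c} \<Longrightarrow> x \<noteq> y \<Longrightarrow> R u x \<Longrightarrow> R w y \<Longrightarrow> \<not> R u w"
  shows "has_cycle R V 5"
proof (cases "red_clique (V - {a, b, c})")
  case True
  have "card (V - {a, b, c}) \<ge> 5"
    using card C finite_V by (simp add: card_Diff_subset)
  then show ?thesis
    using red_clique_has_cycle[OF True] by auto
next
  case False
  then obtain u u' where u: "u \<in> V - {a, b, c}" "u' \<in> V - {a, b, c}" "B u u'"
    unfolding red_clique_def B_def by blast
  then have "u \<noteq> u'"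
    by (auto simp: B_def)
  then have "card (V - {a, b, c} - {u, u'}) \<ge> 2"
    using card C u finite_V by (simp add: card_Diff_subset)
  then obtain w w' where w: "w \<in> V - {a, b, c} - {u, u'}" "w' \<in> V - {a, b, c} - {u, u'}" "w \<noteq> w'"
    using obtain_two_distinct by metis
  have key: "\<exists>x\<in>{a, b, c}. R u x \<and> \<not> R v x \<and> B u v \<and> B u' v" if v: "v \<in> V - {a, b, c} - {u, u'}" for v
  proof -
    have no: "\<not> (\<not> R u x \<and> \<not> R x v \<and> \<not> R v y \<and> \<not> R y u')"
      if "x \<in> {a, b, c}" "y \<in> {a, b, c}" "x \<noteq> y" for x y
      using blue_pentagon_False[OF no5, of u x v y u'] that v u C \<open>u \<noteq> u'\<close> unfolding B_def
      by (auto simp: R_commute)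
    \<comment> \<open>As \<open>u\<close>, \<open>u'\<close> and \<open>v\<close> each have at most
      one red neighbour in the triple, the six excluded pentagons \<open>u x v y u'\<close> force
      \<open>u\<close> and \<open>u'\<close> to share theirs and \<open>v\<close> to have a
      different one.\<close>
    have "\<exists>x\<in>{a, b, c}. \<exists>y\<in>{a, b, c}. x \<noteq> y \<and> R u x \<and> R u' x \<and> R v y"
      using no[of a b] no[of a c] no[of b a] no[of b c] no[of c a] no[of c b] C(1)
        one[of u a b] one[of u a c] one[of u b c] one[of u' a b] one[of u' a c] one[of u' b c]
        one[of v a b] one[of v a c] one[of v b c] u v
      by (simp add: R_commute) argo
    then obtain x y where xy: "x \<in> {a, b, c}" "y \<in> {a, b, c}" "x \<noteq> y" "R u x" "R u' x" "R v y"
      by blast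
    have v': "v \<in> V - {a, b, c}" "v \<noteq> u" "v \<noteq> u'"
      using v by auto
    then have "\<not> R u v" "\<not> R u' v" "\<not> R v x"
      using diff[of u v x y] diff[of u' v x y] one[of v x y] xy u by auto
    then show ?thesis
      using xy v' unfolding B_def by auto
  qed
  obtain x where x: "x \<in> {a, b, c}" "R u x" "\<not> R w x" "B u w" "B u' w"
    using key w by blast
  obtain x' where x': "x' \<in> {a, b, c}" "R u x'" "\<not> R w' x'" "B u w'"
    using key w by blast
  then have "x' = x"
    using one[of u x x'] x u by blast
  then have False
    using blue_pentagon_False[OF no5, of u u' w x w'] x x' u w C \<open>u \<noteq> u'\<close> unfolding B_def
    by (auto simp: R_commute)
  then show ?thesis ..
qed

lemma red_cycle_length_ge_four_exists:
  assumes no5: "\<not> has_cycle B V 5" and card: "card V \<ge> 8"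
  obtains xs where "is_cycle R V xs" "4 \<le> length xs"
proof (rule ccontr)
  assume "\<not> thesis"
  then have no: "\<not> is_cycle R V xs" if "length xs \<ge> 4" for xs
    using that \<open>\<And>xs. is_cycle R V xs \<Longrightarrow> 4 \<le> length xs \<Longrightarrow> thesis\<close> by blast
  then have no5': "\<not> has_cycle R V 5"
    unfolding has_cycle_def by fastforce
  \<comment> \<open>The red graph has a triangle, or a path on three vertices but no triangle, or it
    is a matching. The triple is the triangle, the path, or any three vertices.\<close>
  consider (triangle) a b c where "is_cycle R V [a, b, c]"
    | (path) a b c where "\<And>a b c. \<not> is_cycle R V [a, b, c]" "distinct [a, b, c]" "{a, b, c} \<subseteq> V"
        "R a b" "R b c"
    | (matching) "\<And>a b c. a \<in> V \<Longrightarrow> b \<in> V \<Longrightarrow> c \<in> V \<Longrightarrow> R a b \<Longrightarrow> R b c \<Longrightarrow> a = c"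
    using R_irrefl by (metis distinct_length_2_or_more distinct_singleton empty_subsetI insert_subset)
  then show False
  proof cases
    case triangle
    then have *: "distinct [a, b, c]" "{a, b, c} \<subseteq> V" "R a b" "R b c" "R c a"
      by (auto simp: is_cycle_def)
    have "has_cycle R V 5"
    proof (rule three_vertices_red_pentagon[OF no5 card *(1,2)])
      show "\<not> (R u x \<and> R u y)" if "u \<in> V - {a, b, c}" "x \<in> {a, b, c}" "y \<in> {a, b, c}" "x \<noteq> y" for u x y
        using that * no[of "[u, a, c, b]"] no[of "[u, a, b, c]"] no[of "[u, b, a, c]"]
        by (auto simp: is_cycle_def R_commute)
      show "\<not> R u w" if "u \<in> V - {a, b, c}" "w \<in> V - {a, b, c}" "u \<noteq> w"
        "x \<in> {a, b, c}" "y \<in> {a, b, c}" "x \<noteq> y" "R u x" "R w y" for u w x y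
        using that * no[of "[u, x, y, w]"] by (auto simp: is_cycle_def R_commute)
    qed
    then show False using no5' by blast
  next
    case path
    have "has_cycle R V 5"
    proof (rule three_vertices_red_pentagon[OF no5 card path(2,3)])
      show "\<not> (R u x \<and> R u y)" if "u \<in> V - {a, b, c}" "x \<in> {a, b, c}" "y \<in> {a, b, c}" "x \<noteq> y" for u x y
        using that path(2-5) no[of "[u, a, b, c]"] path(1)[of u a b] path(1)[of u b c]
        by (auto simp: is_cycle_def R_commute)
      show "\<not> R u w" if "u \<in> V - {a, b, c}" "w \<in> V - {a, b, c}" "u \<noteq> w"
        "x \<in> {a, b, c}" "y \<in> {a, b, c}" "x \<noteq> y" "R u x" "R w y" for u w x y
        using that path(2-5) no[of "[u, x, y, w]"] no[of "[u, x, b, y, w]"]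
        by (auto simp: is_cycle_def R_commute)
    qed
    then show False using no5' by blast
  next
    case matching
    obtain a b c where *: "a \<in> V" "b \<in> V" "c \<in> V" "distinct [a, b, c]"
      using obtain_three_distinct[of V] card by auto
    have "has_cycle R V 5"
    proof (rule three_vertices_red_pentagon[OF no5 card *(4)])
      show "{a, b, c} \<subseteq> V" using * by blast
      show "\<not> (R u x \<and> R u y)" if "u \<in> V - {a, b, c}" "x \<in> {a, b, c}" "y \<in> {a, b, c}" "x \<noteq> y" for u x y
        using that * matching[of x u y] R_sym by blast
      show "\<not> R u w" if "u \<in> V - {a, b, c}" "w \<in> V - {a, b, c}" "u \<noteq> w"
        "x \<in> {a, b, c}" "y \<in> {a, b, c}" "x \<noteq> y" "R u x" "R w y" for u w x y
        using that * matching[of x u w] R_sym by blast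
    qed
    then show False using no5' by blast
  qed
qed

text \<open>A colouring of five vertices without monochromatic triangle contains a red 5-cycle.
  \<open>step\<close> rebuilds it as \<open>a u w u' b\<close> from a red edge \<open>a b\<close>
  and a blue edge \<open>u u'\<close>.\<close>

lemma red_cycle_length_ge_three_exists:
  assumes no3: "\<not> has_cycle B V 3" and card: "card V \<ge> 5"
  obtains xs where "is_cycle R V xs" "3 \<le> length xs"
proof (rule ccontr)
  assume "\<not> thesis"
  then have no: "\<not> is_cycle R V xs" if "length xs \<ge> 3" for xs
    using that \<open>\<And>xs. is_cycle R V xs \<Longrightarrow> 3 \<le> length xs \<Longrightarrow> thesis\<close> by blast
  note tri = triangle_cycle[OF no3]
  have tri': "\<not> (R x y \<and> R y z \<and> R z x)" if "distinct [x, y, z]" "{x, y, z} \<subseteq> V" for x y z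
    using no[of "[x, y, z]"] that by (auto simp: is_cycle_def)
  obtain a b where ab: "a \<in> V" "b \<in> V" "R a b"
  proof -
    obtain x y z where "x \<in> V" "y \<in> V" "z \<in> V" "distinct [x, y, z]"
      using obtain_three_distinct[of V] card by auto
    then show thesis
      using tri[of x y z] that unfolding B_def by auto
  qed
  then have "a \<noteq> b" using R_irrefl by blast
  then have "card (V - {a, b}) \<ge> 3"
    using card ab finite_V by (simp add: card_Diff_subset)
  then obtain x y z where xyz: "x \<in> V - {a, b}" "y \<in> V - {a, b}" "z \<in> V - {a, b}" "distinct [x, y, z]"
    using obtain_three_distinct by metis
  have False if u: "u \<in> V - {a, b}" and u': "u' \<in> V - {a, b}" and w: "w \<in> V - {a, b}"
    and d: "distinct [u, u', w]" and blue: "B u u'" and ab: "a \<in> V" "b \<in> V" "R a b" "R u a" for a b u u' w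
  proof -
    have D: "distinct [a, b, u, u', w]" "{a, b, u, u', w} \<subseteq> V"
      using u u' w d ab R_irrefl by auto
    have "\<not> R u b" using tri'[of u a b] D ab by (auto simp: R_commute)
    then have "R u' b" using tri[of u' u b] D blue B_commute unfolding B_def by auto
    then have "\<not> R u' a" using tri'[of u' a b] D ab by (auto simp: R_commute)
    have "\<not> R w a"
    proof
      assume "R w a"
      then have "\<not> R w b" using tri'[of w a b] D ab by (auto simp: R_commute)
      then have "R u w" using tri[of u b w] \<open>\<not> R u b\<close> D unfolding B_def by (auto simp: R_commute)
      then show False using tri'[of u w a] \<open>R w a\<close> D ab by (auto simp: R_commute)
    qed
    moreover have "\<not> R w b"
    proof
      assume "R w b"
      have "R u' w" using tri[of u' a w] \<open>\<not> R w a\<close> \<open>\<not> R u' a\<close> D unfolding B_def by (auto simp: R_commute)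
      then show False using tri'[of u' w b] \<open>R w b\<close> \<open>R u' b\<close> D ab by (auto simp: R_commute)
    qed
    ultimately have "R u w" "R u' w"
      using tri[of u b w] tri[of u' a w] D \<open>\<not> R u b\<close> \<open>\<not> R u' a\<close> unfolding B_def
      by (auto simp: R_commute)
    then show False
      using no[of "[a, u, w, u', b]"] D ab \<open>R u' b\<close> by (auto simp: is_cycle_def R_commute)
  qed
  note step = this
  have False if "u \<in> V - {a, b}" "u' \<in> V - {a, b}" "w \<in> V - {a, b}"
    "distinct [u, u', w]" "B u u'" for u u' w
  proof -
    have "R u a \<or> R u' a"
      using tri[of u a u'] that ab unfolding B_def by (auto simp: R_commute)
    then show False
      using step[of u a b u' w] step[of u' a b u w] that ab B_commute by auto
  qed
  then have "R x y" "R y z" "R z x"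
    using xyz unfolding B_def by (metis distinct_length_2_or_more distinct_singleton)+
  then show False
    using tri'[of x y z] xyz by auto
qed

text \<open>Otherwise \<open>u\<close> and the successors of \<open>a\<close> and \<open>b\<close>
  along the cycle would form a blue triangle.\<close>

lemma longest_cycle_outside_one_nbr_triangle:
  assumes no3: "\<not> has_cycle B V 3" and long: "longest_cycle R V xs"
    and u: "u \<in> V - set xs" and ab: "a \<in> set xs" "b \<in> set xs" "R u a" "R u b"
  shows "a = b"
proof (rule ccontr)
  assume "a \<noteq> b"
  then obtain ys zs where long': "longest_cycle R V (a # ys @ b # zs)"
    and set: "set (a # ys @ b # zs) = set xs"
    using longest_cycle_split long ab by metis
  have u': "u \<in> V" "u \<notin> set (a # ys @ b # zs)"
    using u set by auto
  note two = longest_cycle_two_nbrs[OF long' u' ab(3,4)]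
  have "hd ys \<in> V" "hd zs \<in> V" "hd ys \<noteq> hd zs"
    using two(1,2) long' unfolding longest_cycle_def is_cycle_def by (auto dest: hd_in_set)
  then show False
    using triangle_cycle[OF no3, of "hd ys" u "hd zs"] two(3)[of "hd ys"] two(3)[of "hd zs"] two(4) u'(1)
    unfolding B_def by (auto simp: R_commute)
qed

text \<open>If some chord of \<open>C\<close> is blue, its end \<open>x\<close> that is red to all
  of \<open>V - C\<close> moves to that clique. A blue chord inside \<open>C - {x}\<close> would
  yield a second such vertex, and an outside vertex would have two red neighbours on
  \<open>C\<close>.\<close>

lemma outside_red_clique_bipartition:
  assumes "C \<subseteq> V" "V - C \<noteq> {}" "red_clique (V - C)"
    and one: "\<And>u a b. u \<in> V - C \<Longrightarrow> a \<in> C \<Longrightarrow> b \<in> C \<Longrightarrow> R u a \<Longrightarrow> R u b \<Longrightarrow> a = b"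
    and chord: "\<And>x y. x \<in> C \<Longrightarrow> y \<in> C \<Longrightarrow> B x y \<Longrightarrow>
      (\<forall>u\<in>V - C. R u x) \<or> (\<forall>u\<in>V - C. R u y)"
  obtains X Y where "X \<union> Y = V" "X \<inter> Y = {}" "red_clique X" "red_clique Y"
proof (cases "red_clique C")
  case True
  then show thesis
    using that[of C "V - C"] assms by blast
next
  case False
  then obtain x y where "x \<in> C" "y \<in> C" "B x y"
    unfolding red_clique_def B_def by blast
  then obtain x where x: "x \<in> C" "\<forall>u\<in>V - C. R u x"
    using chord by blast
  have "red_clique (insert x (V - C))"
    using assms(3) x unfolding red_clique_def by (auto simp: R_commute)
  moreover have "red_clique (C - {x})"
    unfolding red_clique_def
  proof (intro ballI impI, rule ccontr)
    fix v v'
    assume v: "v \<in> C - {x}" "v' \<in> C - {x}" "v \<noteq> v'" "\<not> R v v'"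
    then have "(\<forall>u\<in>V - C. R u v) \<or> (\<forall>u\<in>V - C. R u v')"
      using chord unfolding B_def by blast
    then show False
      using one assms(2) x v by blast
  qed
  ultimately show thesis
    using that[of "C - {x}" "insert x (V - C)"] assms(1) x(1) by blast
qed

lemma red_bipartition_triangle:
  assumes no3: "\<not> has_cycle B V 3" and noR: "\<not> has_cycle R V n" and n: "n \<ge> 5"
    and card: "card V \<ge> n"
  obtains X Y where "X \<union> Y = V" "X \<inter> Y = {}" "red_clique X" "red_clique Y"
proof -
  obtain xs where long: "longest_cycle R V xs" and len: "3 \<le> length xs"
    using red_cycle_length_ge_three_exists[OF no3] longest_cycle_exists[OF finite_V] card n
    by (metis order_trans)
  have cyc: "is_cycle R V xs" and V: "set xs \<subseteq> V" "distinct xs"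
    using long by (auto simp: longest_cycle_def is_cycle_def)
  have "length xs < n"
    using red_cycle_descend_triangle[OF no3 n cyc] noR by fastforce
  then have ne: "V - set xs \<noteq> {}"
    using card distinct_card[OF V(2)] card_mono[of "set xs" V] by auto
  note one = longest_cycle_outside_one_nbr_triangle[OF no3 long]
  note tri = triangle_cycle[OF no3]
  have clique: "red_clique (V - set xs)"
    unfolding red_clique_def
  proof (intro ballI impI)
    fix u u'
    assume u: "u \<in> V - set xs" "u' \<in> V - set xs" "u \<noteq> u'"
    \<comment> \<open>\<open>u\<close> and \<open>u'\<close> have at most one red neighbour each on
      the cycle, so one of three cycle vertices is blue to both.\<close>
    obtain x y z where "x \<in> set xs" "y \<in> set xs" "z \<in> set xs" "distinct [x, y, z]"
      using obtain_three_distinct[of "set xs"] len distinct_card[OF V(2)] by auto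
    then obtain v where v: "v \<in> set xs" "\<not> R u v" "\<not> R u' v"
      using one[OF u(1)] one[OF u(2)] by (metis distinct_length_2_or_more)
    have "B u v" "B v u'"
      using v u unfolding B_def by (auto simp: R_commute)
    then show "R u u'"
      using tri[of u v u'] u v V by auto
  qed
  show thesis
  proof (rule outside_red_clique_bipartition[OF V(1) ne clique])
    show "a = b" if "u \<in> V - set xs" "a \<in> set xs" "b \<in> set xs" "R u a" "R u b" for u a b
      using one that by blast
    show "(\<forall>u\<in>V - set xs. R u x) \<or> (\<forall>u\<in>V - set xs. R u y)"
      if xy: "x \<in> set xs" "y \<in> set xs" "B x y" for x y
    proof (rule ccontr)
      assume "\<not> ?thesis"
      then obtain u w where uw: "u \<in> V - set xs" "w \<in> V - set xs" "\<not> R w x" "\<not> R u y" by blast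
      have cover: "R v p \<or> R v q" if "v \<in> V - set xs" "p \<in> set xs" "q \<in> set xs" "B p q" for v p q
        using tri[of v p q] that V unfolding B_def by (auto simp: R_commute)
      have red: "R u x" "R w y"
        using cover[OF _ xy] uw by blast+
      then have neq: "u \<noteq> w" "x \<noteq> y"
        using uw xy by (auto simp: B_def)
      \<comment> \<open>On the cycle \<open>u\<close> is red only to \<open>x\<close>, and
        \<open>w\<close> only to \<open>y\<close>, so by \<open>cover\<close> a blue pair contains
        both. Up to this pair the cycle vertices form a red clique and may be reordered:
        \<open>x u w y\<close> followed by the rest beats the longest cycle by two.\<close>
      have clique': "R p q" if "p \<in> set xs" "q \<in> set xs" "p \<noteq> q" "{p, q} \<noteq> {x, y}" for p q
        using cover[of u p q] cover[of w p q] one[OF uw(1)] one[OF uw(2)] red that uw xy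
        unfolding B_def by (metis doubleton_eq_iff)
      obtain ys zs where cyc': "is_cycle R V (x # ys @ y # zs)" and set: "set (x # ys @ y # zs) = set xs"
        and length: "length (x # ys @ y # zs) = length xs"
        using is_cycle_Cons_Cons_obtain[OF cyc xy(1,2) neq(2)] by metis
      define rest where "rest = ys @ zs"
      have rest: "rest \<noteq> []" "distinct rest" "set rest \<subseteq> set xs - {x, y}"
        "length rest + 2 = length xs"
        using len length cyc' set unfolding rest_def is_cycle_def by auto
      have "red_clique (set rest)"
        using clique' rest(3) unfolding red_clique_def by (auto simp: doubleton_eq_iff)
      then have "successively R rest"
        using red_clique_successively rest(2) by blast
      moreover have "hd rest \<in> set xs - {x, y}" "last rest \<in> set xs - {x, y}"
        using rest(1,3) hd_in_set last_in_set by blast+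
      then have "R y (hd rest)" "R (last rest) x"
        using clique'[of y "hd rest"] clique'[of "last rest" x] xy by (auto simp: doubleton_eq_iff)
      moreover have "R u w"
        using red_cliqueD[OF clique uw(1,2) neq(1)] .
      ultimately have "is_cycle R V (x # u # w # y # rest)"
        using rest uw red xy neq V by (auto simp: is_cycle_def successively_Cons R_commute)
      then show False
        using longest_cycleD[OF long] rest(4) by fastforce
    qed
  qed (use that in blast)
qed

lemma red_bipartition_pentagon:
  assumes no5: "\<not> has_cycle B V 5" and noR: "\<not> has_cycle R V n" and n: "n \<ge> 6"
    and card: "card V \<ge> n + 2"
  obtains X Y where "X \<union> Y = V" "X \<inter> Y = {}" "red_clique X" "red_clique Y"
proof -
  have "card V \<ge> 8"
    using card n by simp
  then obtain zs where zs: "is_cycle R V zs" "4 \<le> length zs"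
    by (rule red_cycle_length_ge_four_exists[OF no5])
  then obtain xs where long: "longest_cycle R V xs" and "length zs \<le> length xs"
    using longest_cycle_exists[OF finite_V] by metis
  then have len: "4 \<le> length xs"
    using zs by simp
  have cyc: "is_cycle R V xs" and V: "set xs \<subseteq> V" "distinct xs"
    using long by (auto simp: longest_cycle_def is_cycle_def)
  have "length xs < n"
    using red_cycle_descend_pentagon[OF no5 n card cyc] noR by fastforce
  \<comment> \<open>The cycle takes at most \<open>n - 1\<close> of at least \<open>n + 2\<close>
    vertices.\<close>
  then have card_U: "card (V - set xs) \<ge> 3"
    using card distinct_card[OF V(2)] V(1) by (simp add: card_Diff_subset)
  then have ne: "V - set xs \<noteq> {}"
    by (metis card.empty not_numeral_le_zero)
  note one = longest_cycle_outside_one_nbr[OF no5 long card_U]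
  \<comment> \<open>Of at least four cycle vertices, \<open>u\<close> and \<open>w\<close> spoil at
    most one each. Two remaining ones allow the pentagon below to have distinct vertices
    \<open>x\<close> and \<open>y\<close>.\<close>
  have common: "card {v \<in> set xs. \<not> R u v \<and> \<not> R w v} \<ge> 2" if "u \<in> V - set xs" "w \<in> V - set xs" for u w
  proof -
    have N: "card {v \<in> set xs. R u v} \<le> 1" if "u \<in> V - set xs" for u
      using one[OF that] by (simp add: card_le_Suc0_iff_eq)
    let ?N = "\<lambda>u. {v \<in> set xs. R u v}" and ?D = "{v \<in> set xs. \<not> R u v \<and> \<not> R w v}"
    have "set xs = ?D \<union> (?N u \<union> ?N w)"
      by blast
    then have "card (set xs) = card (?D \<union> (?N u \<union> ?N w))"
      by (rule arg_cong)
    also have "\<dots> \<le> card ?D + card (?N u \<union> ?N w)"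
      by (rule card_Un_le)
    finally have "card (set xs) \<le> card ?D + card (?N u \<union> ?N w)" .
    moreover have "card (?N u \<union> ?N w) \<le> card (?N u) + card (?N w)"
      by (rule card_Un_le)
    ultimately have "card (set xs) \<le> card ?D + card (?N u) + card (?N w)"
      by linarith
    then show ?thesis
      using N[OF that(1)] N[OF that(2)] len distinct_card[OF V(2)] by linarith
  qed
  have clique: "red_clique (V - set xs)"
    unfolding red_clique_def
  proof (intro ballI impI, rule ccontr)
    fix u u'
    assume u: "u \<in> V - set xs" "u' \<in> V - set xs" "u \<noteq> u'" "\<not> R u u'"
    have "card (V - set xs - {u, u'}) \<ge> 1"
      using card_U u finite_V by (simp add: card_Diff_subset)
    then obtain w where w: "w \<in> V - set xs" "w \<noteq> u" "w \<noteq> u'"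
      by (metis DiffE card.empty ex_in_conv insertCI not_one_le_zero)
    obtain x where "x \<in> {v \<in> set xs. \<not> R u v \<and> \<not> R w v}"
      by (rule obtain_two_distinct[OF common[OF u(1) w(1)]])
    then have x: "x \<in> set xs" "\<not> R u x" "\<not> R w x"
      by auto
    obtain y1 y2 where "y1 \<in> {v \<in> set xs. \<not> R w v \<and> \<not> R u' v}" "y1 \<noteq> y2"
      "y2 \<in> {v \<in> set xs. \<not> R w v \<and> \<not> R u' v}"
      by (rule obtain_two_distinct[OF common[OF w(1) u(2)]])
    then obtain y where "y \<in> set xs" "x \<noteq> y" "\<not> R w y" "\<not> R u' y"
      by (cases "x = y1") auto
    then show False
      using blue_pentagon_False[OF no5, of u x w y u'] x u w V unfolding B_def
      by (auto simp: R_commute)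
  qed
  show thesis
  proof (rule outside_red_clique_bipartition[OF V(1) ne clique])
    show "a = b" if "u \<in> V - set xs" "a \<in> set xs" "b \<in> set xs" "R u a" "R u b" for u a b
      using one that by blast
    show "(\<forall>u\<in>V - set xs. R u x) \<or> (\<forall>u\<in>V - set xs. R u y)"
      if xy: "x \<in> set xs" "y \<in> set xs" "B x y" for x y
    proof (rule ccontr)
      assume "\<not> ?thesis"
      then obtain p q where pq: "p \<in> V - set xs" "q \<in> V - set xs" "\<not> R p x" "\<not> R q y"
        by blast
      have "card (set xs - {x, y}) \<ge> 2"
        using len distinct_card[OF V(2)] xy by (simp add: card_Diff_subset B_def)
      then obtain d e where de: "d \<in> set xs - {x, y}" "e \<in> set xs - {x, y}" "d \<noteq> e"
        using obtain_two_distinct by metis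
      have no: "\<not> (\<not> R u x \<and> \<not> R u v \<and> \<not> R w v \<and> \<not> R w y)"
        if "u \<in> V - set xs" "w \<in> V - set xs" "u \<noteq> w" "v \<in> set xs - {x, y}" for u w v
        using blue_pentagon_False[OF no5, of x u v w y] that xy V unfolding B_def
        by (auto simp: R_commute)
      have at_most: "\<not> (R u x \<and> R u y)" "\<not> (R u x \<and> R u d)" "\<not> (R u x \<and> R u e)"
        "\<not> (R u y \<and> R u d)" "\<not> (R u y \<and> R u e)" "\<not> (R u d \<and> R u e)" if "u \<in> V - set xs" for u
        using one[OF that, of x y] one[OF that, of x d] one[OF that, of x e] one[OF that, of y d]
          one[OF that, of y e] one[OF that, of d e] xy de B_def by auto
      \<comment> \<open>If \<open>u\<close> is not red to \<open>x\<close> and \<open>w\<close> not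
        red to \<open>y\<close>, the pentagons through \<open>d\<close> and \<open>e\<close> make
        one of them red to \<open>d\<close> and the other to \<open>e\<close>; a third outside
        vertex would then be red to both \<open>d\<close> and \<open>e\<close>. Hence any three
        outside vertices agree on \<open>x\<close> or on \<open>y\<close>.\<close>
      have three: "R u x \<and> R v x \<and> R w x \<or> R u y \<and> R v y \<and> R w y"
        if "u \<in> V - set xs" "v \<in> V - set xs" "w \<in> V - set xs" "distinct [u, v, w]" for u v w
        using at_most[OF that(1)] at_most[OF that(2)] at_most[OF that(3)]
          no[OF that(1,2) _ de(1)] no[OF that(1,2) _ de(2)] no[OF that(2,1) _ de(1)]
          no[OF that(2,1) _ de(2)] no[OF that(1,3) _ de(1)] no[OF that(1,3) _ de(2)]
          no[OF that(3,1) _ de(1)] no[OF that(3,1) _ de(2)] no[OF that(2,3) _ de(1)]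
          no[OF that(2,3) _ de(2)] no[OF that(3,2) _ de(1)] no[OF that(3,2) _ de(2)] that(4)
        by simp argo
      have "\<not> V - set xs \<subseteq> {p, q}"
        using card_U card_mono[of "{p, q}" "V - set xs"] card_insert_le_m1[of 2 "{q}" p] by auto
      then obtain w where w: "w \<in> V - set xs" "w \<noteq> p" "w \<noteq> q"
        by blast
      show False
      proof (cases "p = q")
        case False
        then show False using three[of p q w] w pq by auto
      next
        case True
        have "\<not> V - set xs \<subseteq> {p, w}"
          using card_U card_mono[of "{p, w}" "V - set xs"] card_insert_le_m1[of 2 "{w}" p] by auto
        then obtain w' where "w' \<in> V - set xs" "w' \<noteq> p" "w' \<noteq> w"
          by blast
        then show False using three[of p w w'] w pq True by auto
      qed
    qed
  qed (use that in blast)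
qed

end

section \<open>Edges between the two cliques\<close>

lemma successively_splice:
  assumes "length xs = Suc (length ys)" "\<And>x y. x \<in> set xs \<Longrightarrow> y \<in> set ys \<Longrightarrow> E x y \<and> E y x"
  shows "successively E (splice xs ys) \<and> hd (splice xs ys) = hd xs \<and> last (splice xs ys) = last xs"
  using assms
proof (induction ys arbitrary: xs)
  case Nil
  then show ?case
    by (cases xs) auto
next
  case (Cons y ys)
  then obtain x x' xs' where xs: "xs = x # x' # xs'"
    by (auto simp: length_Suc_conv)
  have "successively E (splice (x' # xs') ys) \<and> hd (splice (x' # xs') ys) = x' \<and>
      last (splice (x' # xs') ys) = last (x' # xs')"
    using Cons.IH[of "x' # xs'"] Cons.prems xs by simp
  moreover have "splice xs (y # ys) = x # y # splice (x' # xs') ys"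
    by (simp add: xs)
  moreover have "splice (x' # xs') ys \<noteq> []"
    by simp
  ultimately show ?case
    using Cons.prems(2)[of x y] Cons.prems(2)[of x' y] xs by (simp add: successively_Cons)
qed

text \<open>The cycle passes through \<open>x\<close> between \<open>a\<close> and \<open>b\<close>
  and otherwise alternates between \<open>r - 1\<close> vertices of \<open>X - {x}\<close> and
  \<open>r\<close> vertices of \<open>Y\<close>. This form covers the centre of a star as well as a
  complete bipartite graph.\<close>

lemma bipartite_even_cycle:
  assumes sym: "symp E" and fin: "finite X" "finite Y" and sub: "X \<subseteq> V" "Y \<subseteq> V" "X \<inter> Y = {}"
    and x: "x \<in> X" "a \<in> Y" "b \<in> Y" "a \<noteq> b" "E x a" "E x b"
    and complete: "\<And>v w. v \<in> X - {x} \<Longrightarrow> w \<in> Y \<Longrightarrow> E v w"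
    and r: "r \<ge> 2" "r \<le> card X" "r \<le> card Y"
  shows "has_cycle E V (2 * r)"
proof -
  have "r - 1 \<le> card (X - {x})" "r - 2 \<le> card (Y - {a, b})"
    using fin x r by (auto simp: card_Diff_subset)
  then obtain xs ys where xs: "distinct xs" "set xs \<subseteq> X - {x}" "length xs = r - 1"
    and ys: "distinct ys" "set ys \<subseteq> Y - {a, b}" "length ys = r - 2"
    using distinct_list_obtain fin by (metis finite_Diff)
  define zs where "zs = a # ys @ [b]"
  have zs: "distinct zs" "set zs \<subseteq> Y" "length zs = Suc (length xs)"
    using ys xs(3) x r(1) unfolding zs_def by auto
  have "E v w \<and> E w v" if "v \<in> set zs" "w \<in> set xs" for v w
    using complete[of w v] sympD[OF sym] that xs(2) zs(2) by blast
  then have s: "successively E (splice zs xs)" "hd (splice zs xs) = a" "last (splice zs xs) = b"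
    using successively_splice[OF zs(3), of E] by (auto simp: zs_def)
  have shuffle: "splice zs xs \<in> shuffles zs xs"
    by (rule splice_in_shuffles)
  then have set: "set (splice zs xs) = set zs \<union> set xs"
    by (rule set_shuffles)
  have "set zs \<inter> set xs = {}"
    using zs(2) xs(2) sub by blast
  then have "distinct (splice zs xs)"
    using distinct_disjoint_shuffles[OF zs(1) xs(1) _ shuffle] by blast
  moreover have "x \<notin> set zs \<union> set xs"
    using zs(2) xs(2) sub x by blast
  moreover have "set zs \<union> set xs \<subseteq> V" "x \<in> V"
    using zs(2) xs(2) sub x by blast+
  moreover have "splice zs xs \<noteq> []"
    using zs(3) arg_cong[of "splice zs xs" "[]" length] by auto
  ultimately have "is_cycle E V (x # splice zs xs)"
    using s set x sympD[OF sym] by (auto simp: is_cycle_def successively_Cons)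
  moreover have "length (x # splice zs xs) = 2 * r"
    using zs(3) xs(3) r(1) by simp
  ultimately show ?thesis
    by (rule has_cycleI)
qed

context red_blue_relation
begin

section \<open>Red cycles through one or two cliques\<close>

lemma red_clique_path:
  assumes S: "red_clique S" "S \<subseteq> V" and xy: "x \<in> S" "y \<in> S" "x \<noteq> y" and m: "2 \<le> m" "m \<le> card S"
  obtains xs where "successively R xs" "distinct xs" "set xs \<subseteq> S" "hd xs = x" "last xs = y"
    "length xs = m"
proof -
  have fin: "finite S"
    using S(2) finite_V finite_subset by blast
  then have "m - 2 \<le> card (S - {x, y})"
    using xy m by (simp add: card_Diff_subset)
  then obtain zs where "distinct zs" "set zs \<subseteq> S - {x, y}" "length zs = m - 2"
    using distinct_list_obtain fin by (metis finite_Diff)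
  then have "distinct (x # zs @ [y])" "set (x # zs @ [y]) \<subseteq> S" "length (x # zs @ [y]) = m"
    using xy m by auto
  then show thesis
    using that[of "x # zs @ [y]"] red_clique_successively[OF S(1)] by auto
qed

lemma red_clique_insert_cycle:
  assumes S: "red_clique S" "S \<subseteq> V" and x: "x \<in> V" "x \<notin> S" "y \<in> S" "z \<in> S" "y \<noteq> z" "R x y" "R x z"
    and m: "3 \<le> m" "m \<le> Suc (card S)"
  shows "has_cycle R V m"
proof -
  have "2 \<le> m - 1" "m - 1 \<le> card S"
    using m by auto
  then obtain xs where xs: "successively R xs" "distinct xs" "set xs \<subseteq> S" "hd xs = y" "last xs = z"
    "length xs = m - 1"
    using red_clique_path[OF S x(3-5)] by metis
  then have "is_cycle R V (x # xs)"
    using x S(2) m by (auto simp: is_cycle_def successively_Cons R_commute)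
  then show ?thesis
    using has_cycleI[of R V "x # xs" m] xs(6) m by simp
qed

lemma red_cliques_two_edges_cycle:
  assumes X: "red_clique X" "X \<subseteq> V" and Y: "red_clique Y" "Y \<subseteq> V" and disj: "X \<inter> Y = {}"
    and x: "x \<in> X" "x' \<in> X" "x \<noteq> x'" and y: "y \<in> Y" "y' \<in> Y" "y \<noteq> y'"
    and red: "R x y" "R x' y'" and m: "4 \<le> m" "m \<le> card X + card Y"
  shows "has_cycle R V m"
proof -
  have "finite X" "finite Y"
    using X Y finite_V finite_subset by blast+
  then have two: "2 \<le> card X" "2 \<le> card Y"
    using card_mono[of X "{x, x'}"] card_mono[of Y "{y, y'}"] x y by auto
  \<comment> \<open>The share of the cycle in \<open>X\<close>: as large as possible, so that the
    rest fits into \<open>Y\<close>, yet leaving two vertices there as ends of the two cross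
    edges.\<close>
  define s where "s = min (card X) (m - 2)"
  have s: "2 \<le> s" "s \<le> card X" "2 \<le> m - s" "m - s \<le> card Y" "s \<le> m"
    using two m unfolding s_def by auto
  obtain xs where xs: "successively R xs" "distinct xs" "set xs \<subseteq> X" "hd xs = x" "last xs = x'"
    "length xs = s"
    using red_clique_path[OF X x s(1,2)] by metis
  obtain ys where ys: "successively R ys" "distinct ys" "set ys \<subseteq> Y" "hd ys = y'" "last ys = y"
    "length ys = m - s"
    using red_clique_path[OF Y y(2,1) _ s(3,4)] y(3) by metis
  have "xs \<noteq> []" "ys \<noteq> []"
    using xs(6) ys(6) s by auto
  moreover have "set xs \<inter> set ys = {}"
    using xs(3) ys(3) disj by blast
  ultimately have "is_cycle R V (xs @ ys)"
    using xs ys X(2) Y(2) red by (auto simp: is_cycle_def successively_append_iff R_commute)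
  then show ?thesis
    using has_cycleI[of R V "xs @ ys" m] xs(6) ys(6) s(5) by simp
qed

text \<open>Disjoint red cross edges would give a red cycle of length \<open>m\<close>, so any two
  of them meet, and pairwise meeting edges of a bipartite graph form a star. \<open>P\<close> is the
  side of its centre; without red cross edges any vertex serves.\<close>

lemma cross_edges_star:
  assumes X: "red_clique X" "X \<subseteq> V" and Y: "red_clique Y" "Y \<subseteq> V" and disj: "X \<inter> Y = {}"
    and ne: "X \<union> Y \<noteq> {}" and noR: "\<not> has_cycle R V m" and m: "4 \<le> m" "m \<le> card X + card Y"
  obtains x P Q where "P = X \<and> Q = Y \<or> P = Y \<and> Q = X" "x \<in> P"
    "\<And>v w. v \<in> P - {x} \<Longrightarrow> w \<in> Q \<Longrightarrow> B v w"
proof -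
  have no: "x = x' \<or> y = y'" if "x \<in> X" "x' \<in> X" "y \<in> Y" "y' \<in> Y" "R x y" "R x' y'" for x x' y y'
    using red_cliques_two_edges_cycle[OF X Y disj, of x x' y y' m] that noR m by blast
  have star: "(\<exists>x\<in>X. \<forall>v\<in>X - {x}. \<forall>w\<in>Y. \<not> R v w) \<or> (\<exists>y\<in>Y. \<forall>v\<in>Y - {y}. \<forall>w\<in>X. \<not> R v w)"
  proof (cases "\<exists>x\<in>X. \<exists>y\<in>Y. R x y")
    case True
    then obtain x y where xy: "x \<in> X" "y \<in> Y" "R x y" by blast
    show ?thesis
    proof (rule ccontr)
      assume "\<not> ?thesis"
      then obtain v w v' w' where "v \<in> X - {x}" "w \<in> Y" "R v w" "v' \<in> Y - {y}" "w' \<in> X" "R v' w'"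
        using xy by blast
      then show False
        using no[of x v y w] no[of x w' y v'] no[of v w' w v'] xy R_commute by auto
    qed
  next
    case False
    then show ?thesis
      using ne R_commute by blast
  qed
  then show thesis
  proof (elim disjE bexE)
    fix x assume "x \<in> X" "\<forall>v\<in>X - {x}. \<forall>w\<in>Y. \<not> R v w"
    then show thesis
      using that[of X Y x] disj unfolding B_def by blast
  next
    fix y assume "y \<in> Y" "\<forall>v\<in>Y - {y}. \<forall>w\<in>X. \<not> R v w"
    then show thesis
      using that[of Y X y] disj unfolding B_def by blast
  qed
qed

section \<open>Sizes of the two cliques\<close>

lemma red_clique_card_less:
  assumes "red_clique S" "S \<subseteq> V" "\<not> has_cycle R V n" "n \<ge> 2"
  shows "card S < n"
  using red_clique_has_cycle[OF assms(1,2), of n] assms(3,4) by linarith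

text \<open>If \<open>Q\<close> and \<open>P\<close> without the star centre both had
  \<open>r\<close> vertices, they would contain a blue cycle of length \<open>2 * r\<close>; with
  the bound \<open>n\<close> on red cliques this leaves four pairs of sizes. In the proof
  \<open>P\<close> is the side of the centre, in the conclusion the larger side, so the roles are
  exchanged in some cases.\<close>

lemma bipartition_structure_bounded:
  assumes part: "X \<union> Y = V" "X \<inter> Y = {}" "red_clique X" "red_clique Y"
    and noR: "\<not> has_cycle R V n" and noB: "\<not> has_cycle B V (2 * r)"
    and r: "2 \<le> r" "r < n" and n: "5 \<le> n" and card: "n + r \<le> card V + 2"
  obtains P Q where "card V + 2 = n + r"
    "P \<union> Q = V" "P \<inter> Q = {}" "red_clique P" "red_clique Q" "card Q \<le> card P"
    "card P = n - 1 \<and> card Q = r - 1 \<and> (\<exists>v\<in>P. \<forall>a\<in>P. \<forall>b\<in>Q. R a b \<longrightarrow> a = v) \<or>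
     card P = n - 2 \<and> card Q = r \<and>
       (\<exists>x\<in>Q. card {a \<in> P. R a x} \<in> {n - 3, n - 2} \<and> (\<forall>a\<in>P. \<forall>b\<in>Q. b \<noteq> x \<longrightarrow> B a b))"
proof -
  have sub: "X \<subseteq> V" "Y \<subseteq> V"
    using part(1) by auto
  have "card V = card X + card Y"
    using part(1,2) sub finite_V card_Un_disjoint finite_subset by metis
  then have "X \<union> Y \<noteq> {}" "4 \<le> n" "n \<le> card X + card Y"
    using card part(1) r n by auto
  then obtain x P Q where PQ: "P = X \<and> Q = Y \<or> P = Y \<and> Q = X" "x \<in> P"
    and star: "\<And>v w. v \<in> P - {x} \<Longrightarrow> w \<in> Q \<Longrightarrow> B v w"
    by (rule cross_edges_star[OF part(3) sub(1) part(4) sub(2) part(2) _ noR]) blast+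
  have P: "red_clique P" "P \<subseteq> V" "finite P" and Q: "red_clique Q" "Q \<subseteq> V" "finite Q"
    and disj: "P \<inter> Q = {}" and un: "P \<union> Q = V"
    using PQ(1) part sub finite_V finite_subset by blast+
  have un': "Q \<union> P = V" and disj': "Q \<inter> P = {}"
    using un disj by auto
  have V: "card V = card P + card Q"
    using card_Un_disjoint[OF P(3) Q(3) disj] un by simp
  have less: "card P < n" "card Q < n"
    using red_clique_card_less[OF _ _ noR] P Q n by auto
  have x: "x \<in> V" "x \<notin> Q"
    using PQ(2) P disj by auto
  have few: "y = z" if "y \<in> Q" "z \<in> Q" "R x y" "R x z" "card Q = n - 1" for y z
    using red_clique_insert_cycle[OF Q(1,2) x that(1,2) _ that(3,4), of n] noR that(5) n by fastforce
  have B_sym': "symp B"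
    using B_sym by (simp add: sympI)
  have blue: "y = z" if "y \<in> Q" "z \<in> Q" "B x y" "B x z" "r \<le> card P" "r \<le> card Q" for y z
    using bipartite_even_cycle[OF B_sym' P(3) Q(3) P(2) Q(2) disj PQ(2) that(1,2) _ that(3,4) star r(1)]
      noB that(5,6) by blast
  have complete: False if lt: "r < card P" and le: "r \<le> card Q"
  proof -
    have "r \<le> card (P - {x})"
      using lt PQ(2) by simp
    obtain v where v: "v \<in> P - {x}"
      by (rule obtain_two_distinct[OF order_trans[OF r(1) \<open>r \<le> card (P - {x})\<close>]])
    obtain y z where "y \<in> Q" "z \<in> Q" "y \<noteq> z"
      by (rule obtain_two_distinct[OF order_trans[OF r(1) le]])
    then show False
      using bipartite_even_cycle[OF B_sym', of "P - {x}" Q V v y z r] P Q disj v star r(1)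
        \<open>r \<le> card (P - {x})\<close> le noB by blast
  qed
  have star': "R a b \<Longrightarrow> a = x" if "a \<in> P" "b \<in> Q" for a b
    using star[of a b] that unfolding B_def by blast
  consider "card P = n - 1" "card Q = r - 1" | "card P = r" "card Q = n - 2" "r \<le> n - 2"
    | "card P = r" "card Q = n - 1" | "card P = r - 1" "card Q = n - 1"
  proof -
    consider "r < card P" | "card P = r" | "card P < r"
      by linarith
    then show thesis
    proof cases
      case 1
      then have "card Q < r"
        using complete not_le by blast
      then show thesis
        using that(1) less(1) V card by linarith
    next
      case 2
      then have "card Q = n - 2 \<or> card Q = n - 1"
        using less(2) V card by linarith
      then show thesis
      proof
        assume Q2: "card Q = n - 2"
        show thesis
        proof (cases "r \<le> n - 2")
          case True
          then show thesis using that(2) 2 Q2 by blast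
        next
          \<comment> \<open>Here \<open>r = n - 1\<close>, so the sizes are \<open>n - 1\<close> and
            \<open>r - 1\<close>, the first pair.\<close>
          case False
          then show thesis using that(1) 2 Q2 r by linarith
        qed
      qed (use that(3) 2 in blast)
    next
      case 3
      then show thesis
        using that(4) less(2) V card by linarith
    qed
  qed
  then show thesis
  proof cases
    case 1
    then have "card P = n - 1 \<and> card Q = r - 1 \<and> (\<exists>v\<in>P. \<forall>a\<in>P. \<forall>b\<in>Q. R a b \<longrightarrow> a = v)"
      using PQ(2) star' by blast
    moreover have "card V + 2 = n + r" "card Q \<le> card P"
      using 1 V r n by auto
    ultimately show thesis
      using that[OF _ un disj P(1) Q(1)] by blast
  next
    case 2
    \<comment> \<open>A centre with two blue edges into \<open>Q\<close> would lie on a blue cycle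
      of length \<open>2 * r\<close>.\<close>
    have "card (Q - {a \<in> Q. R a x}) \<le> 1"
      using blue 2 x unfolding B_def by (auto simp: card_le_Suc0_iff_eq Q(3) R_commute)
    moreover have "card {a \<in> Q. R a x} \<le> card Q"
      using Q(3) by (intro card_mono) auto
    ultimately have "card {a \<in> Q. R a x} \<in> {n - 3, n - 2}"
      using 2 Q(3) n by (auto simp: card_Diff_subset)
    moreover have "\<forall>a\<in>Q. \<forall>b\<in>P. b \<noteq> x \<longrightarrow> B a b"
      using star B_commute by blast
    ultimately have "card Q = n - 2 \<and> card P = r \<and>
       (\<exists>x\<in>P. card {a \<in> Q. R a x} \<in> {n - 3, n - 2} \<and> (\<forall>a\<in>Q. \<forall>b\<in>P. b \<noteq> x \<longrightarrow> B a b))"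
      using 2 PQ(2) by blast
    moreover have "card V + 2 = n + r" "card P \<le> card Q"
      using 2 V r n by auto
    ultimately show thesis
      using that[OF _ un' disj' Q(1) P(1)] by blast
  next
    case 3
    \<comment> \<open>The centre has at most one red and at most one blue edge to \<open>Q\<close>,
      which has at least four vertices.\<close>
    have "card Q \<le> card {y \<in> Q. R x y} + card {y \<in> Q. B x y}"
      using x Q(3) card_Un_le[of "{y \<in> Q. R x y}" "{y \<in> Q. B x y}"]
        card_mono[of "{y \<in> Q. R x y} \<union> {y \<in> Q. B x y}" Q] unfolding B_def by fastforce
    moreover have "card {y \<in> Q. R x y} \<le> 1"
      using few 3 by (auto simp: card_le_Suc0_iff_eq Q(3))
    moreover have "card {y \<in> Q. B x y} \<le> 1"
      using blue 3 r(2) by (auto simp: card_le_Suc0_iff_eq Q(3))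
    ultimately have False
      using 3 n by linarith
    then show thesis ..
  next
    case 4
    \<comment> \<open>Two red edges from \<open>x\<close> to \<open>Q\<close> would close a red
      cycle of length \<open>n\<close>, so the star has at most one edge and can be recentred in the
      larger clique.\<close>
    have "\<exists>v\<in>Q. \<forall>a\<in>Q. \<forall>b\<in>P. R a b \<longrightarrow> a = v"
    proof (cases "\<exists>v\<in>Q. R x v")
      case True
      then show ?thesis
        using few[OF _ _ _ _ 4(2)] star' R_commute by metis
    next
      case False
      have "Q \<noteq> {}" using 4 n by auto
      then show ?thesis
        using False star' R_commute by blast
    qed
    then have "card Q = n - 1 \<and> card P = r - 1 \<and> (\<exists>v\<in>Q. \<forall>a\<in>Q. \<forall>b\<in>P. R a b \<longrightarrow> a = v)"
      using 4 by blast
    moreover have "card V + 2 = n + r" "card P \<le> card Q"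
      using 4 V r n by auto
    ultimately show thesis
      using that[OF _ un' disj' Q(1) P(1)] by blast
  qed
qed

text \<open>Red cliques have fewer than \<open>n\<close> vertices, which fixes both sizes. Two red
  cross edges then give a red cycle of length \<open>n\<close>, whether they are disjoint or share
  an end; in the latter case that end is inserted into the opposite clique.\<close>

lemma bipartition_structure_unbounded:
  assumes part: "X \<union> Y = V" "X \<inter> Y = {}" "red_clique X" "red_clique Y"
    and noR: "\<not> has_cycle R V n" and n: "5 \<le> n" and card: "2 * n \<le> card V + 2"
  obtains "card V + 2 = 2 * n" "card X = n - 1" "card Y = n - 1"
    "\<And>a b a' b'. a \<in> X \<Longrightarrow> a' \<in> X \<Longrightarrow> b \<in> Y \<Longrightarrow> b' \<in> Y \<Longrightarrow> R a b \<Longrightarrow> R a' b' \<Longrightarrow> a = a' \<and> b = b'"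
proof -
  have sub: "X \<subseteq> V" "Y \<subseteq> V"
    using part(1) by auto
  have V: "card V = card X + card Y"
    using part(1,2) sub finite_V card_Un_disjoint finite_subset by metis
  have "card X < n" "card Y < n"
    using red_clique_card_less[OF _ _ noR] part sub n by auto
  then have eq: "card X = n - 1" "card Y = n - 1"
    using V card n by auto
  have few: "y = z" if "S = X \<and> T = Y \<or> S = Y \<and> T = X" "x \<in> S" "y \<in> T" "z \<in> T" "R x y" "R x z" for S T x y z
    using red_clique_insert_cycle[of T x y z n] noR n eq part sub that by fastforce
  show thesis
  proof (rule that)
    show "a = a' \<and> b = b'" if "a \<in> X" "a' \<in> X" "b \<in> Y" "b' \<in> Y" "R a b" "R a' b'" for a b a' b'
      using red_cliques_two_edges_cycle[OF part(3) sub(1) part(4) sub(2) part(2), of a a' b b' n]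
        few[of X Y a b b'] few[of Y X b a a'] that noR n eq R_commute by fastforce
  qed (use eq V n in auto)
qed

end

section \<open>Red-blue graphs\<close>

lemma successively_no_crossing:
  assumes "successively E xs" "set xs \<subseteq> P \<union> Q"
    "\<And>p q. p \<in> P \<inter> set xs \<Longrightarrow> q \<in> Q \<inter> set xs \<Longrightarrow> \<not> E p q \<and> \<not> E q p"
  shows "set xs \<subseteq> P \<or> set xs \<subseteq> Q"
  using assms
proof (induction xs)
  case (Cons x xs)
  show ?case
  proof (cases "xs = []")
    case False
    then have "E x (hd xs)" "successively E xs"
      using Cons.prems(1) by (auto simp: successively_Cons)
    moreover have "set xs \<subseteq> P \<or> set xs \<subseteq> Q"
      using Cons.IH \<open>successively E xs\<close> Cons.prems(2,3) by auto
    ultimately show ?thesis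
      using Cons.prems(2) Cons.prems(3)[of x "hd xs"] Cons.prems(3)[of "hd xs" x] hd_in_set[OF False]
      by auto
  qed (use Cons.prems in auto)
qed simp

text \<open>Deleting \<open>v\<close> leaves a path that cannot change sides. A \<open>v\<close>
  outside the vertex set expresses that no edge joins the sides.\<close>

lemma cycle_through_cut_vertex:
  assumes cyc: "is_cycle E V xs" and V: "V \<subseteq> P \<union> Q"
    and cut: "\<And>p q. p \<in> P - {v} \<Longrightarrow> q \<in> Q - {v} \<Longrightarrow> \<not> E p q \<and> \<not> E q p"
  shows "set xs \<subseteq> insert v P \<or> set xs \<subseteq> insert v Q"
proof (cases "v \<in> set xs")
  case True
  then obtain ys where ys: "is_cycle E V (v # ys)" "set (v # ys) = set xs"
    using is_cycle_Cons_obtain[OF cyc] by metis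
  then have "successively E ys" "v \<notin> set ys" "set ys \<subseteq> P \<union> Q"
    using V by (auto simp: is_cycle_def successively_Cons)
  then have "set ys \<subseteq> P \<or> set ys \<subseteq> Q"
    using cut by (intro successively_no_crossing[of E]) blast+
  then show ?thesis
    using ys(2) by auto
next
  case False
  then have "set xs \<subseteq> P \<or> set xs \<subseteq> Q"
    using cyc V cut by (intro successively_no_crossing[of E]) (auto simp: is_cycle_def)
  then show ?thesis by blast
qed

lemma successively_bipartite:
  assumes "successively E xs" "xs \<noteq> []" "hd xs \<in> P" "set xs \<subseteq> P \<union> Q" "P \<inter> Q = {}"
    "\<And>x y. E x y \<Longrightarrow> x \<in> P \<Longrightarrow> y \<notin> P" "\<And>x y. E x y \<Longrightarrow> x \<in> Q \<Longrightarrow> y \<notin> Q"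
  shows "length (filter (\<lambda>x. x \<in> Q) xs) = length xs div 2 \<and> (last xs \<in> P \<longleftrightarrow> odd (length xs))"
  using assms
proof (induction xs rule: induct_list012)
  case (3 x y zs)
  have y: "E x y" "x \<in> P" "x \<notin> Q" "y \<in> Q" "y \<notin> P"
    using "3.prems"(1,3-6) by auto
  show ?case
  proof (cases "zs = []")
    case False
    then have "E y (hd zs)" "successively E zs"
      using "3.prems"(1) by (auto simp: successively_Cons)
    moreover from this have "hd zs \<in> P"
      using "3.prems"(4) "3.prems"(7)[of y "hd zs"] y(4) hd_in_set[OF False] by auto
    ultimately show ?thesis
      using "3.IH"(1) False "3.prems"(4-7) y by auto
  qed (use y in auto)
qed auto

text \<open>One equation serves twice: it makes the length even and bounds it by the size of one
  side.\<close>

lemma cycle_bipartite: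
  assumes cyc: "is_cycle E V xs" and V: "V \<subseteq> P \<union> Q" "P \<inter> Q = {}"
    and P: "\<And>x y. E x y \<Longrightarrow> x \<in> P \<Longrightarrow> y \<notin> P" and Q: "\<And>x y. E x y \<Longrightarrow> x \<in> Q \<Longrightarrow> y \<notin> Q"
  shows "length xs = 2 * card (set xs \<inter> Q)"
proof -
  have E: "E (last xs) (hd xs)" "last xs \<in> set xs" "hd xs \<in> set xs" "set xs \<subseteq> P \<union> Q"
    using cyc V unfolding is_cycle_def by auto
  then obtain x where "x \<in> set xs" "x \<in> P"
    using Q[OF E(1)] by blast
  then obtain ys where ys: "is_cycle E V (x # ys)" "set (x # ys) = set xs" "length (x # ys) = length xs"
    using is_cycle_Cons_obtain[OF cyc] by metis
  have d: "distinct (x # ys)" and s: "successively E (x # ys)" and l: "E (last (x # ys)) x"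
    using ys(1) unfolding is_cycle_def by auto
  have "set (x # ys) \<subseteq> P \<union> Q"
    using E(4) ys(2) by simp
  then have *: "length (filter (\<lambda>v. v \<in> Q) (x # ys)) = length (x # ys) div 2"
    "last (x # ys) \<in> P \<longleftrightarrow> odd (length (x # ys))"
    using successively_bipartite[OF s _ _ _ V(2) P Q] \<open>x \<in> P\<close> by auto
  have "last (x # ys) \<notin> P"
    using P[OF l] \<open>x \<in> P\<close> by blast
  then have "even (length (x # ys))"
    using *(2) by blast
  then have "even (length xs)"
    by (simp only: ys(3))
  moreover have "length (filter (\<lambda>v. v \<in> Q) (x # ys)) = card (set xs \<inter> Q)"
    unfolding distinct_length_filter[OF d] ys(2) by (rule arg_cong[of _ _ card]) auto
  ultimately show ?thesis
    using *(1) ys(3) by auto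
qed

section \<open>Translation between coloured complete graphs and relations\<close>

definition coloured_adj :: "colour \<Rightarrow> 'a red_blue \<Rightarrow> 'a \<Rightarrow> 'a \<Rightarrow> bool" where
  "coloured_adj c G u v \<longleftrightarrow> u \<noteq> v \<and> col G {u, v} = c"

lemma coloured_adj_commute: "coloured_adj c G u v \<longleftrightarrow> coloured_adj c G v u"
  by (auto simp: coloured_adj_def insert_commute)

lemma doubleton_in_colour_graph:
  "{u, v} \<in> snd (colour_graph c G) \<longleftrightarrow> u \<in> verts G \<and> v \<in> verts G \<and> coloured_adj c G u v"
  by (auto simp: colour_graph_def coloured_adj_def doubleton_eq_iff insert_commute)

lemma contains_copy_cycle_iff:
  assumes "3 \<le> k"
  shows "contains_copy (cycle k) (colour_graph c G) \<longleftrightarrow> has_cycle (coloured_adj c G) (verts G) k"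
proof
  assume "contains_copy (cycle k) (colour_graph c G)"
  then obtain f where inj: "inj_on f {..<k}"
    and "subgraph (f ` fst (cycle k), (\<lambda>e. f ` e) ` snd (cycle k)) (colour_graph c G)"
    unfolding contains_copy_def by (auto simp: cycle_def)
  then have sub: "f ` {..<k} \<subseteq> verts G"
    and "(\<lambda>e. f ` e) ` {{i, Suc i mod k} | i. i < k} \<subseteq> snd (colour_graph c G)"
    by (simp_all add: subgraph_def cycle_def colour_graph_def)
  then have edges: "f ` {i, Suc i mod k} \<in> snd (colour_graph c G)" if "i < k" for i
    using that by blast
  have adj: "coloured_adj c G (f i) (f (Suc i mod k))" if "i < k" for i
    using edges[OF that] doubleton_in_colour_graph by (metis image_empty image_insert)
  have "successively (coloured_adj c G) (map f [0..<k])"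
    unfolding successively_conv_nth
  proof (intro allI impI)
    fix i
    assume "Suc i < length (map f [0..<k])"
    then show "coloured_adj c G (map f [0..<k] ! i) (map f [0..<k] ! Suc i)"
      using adj[of i] by simp
  qed
  moreover have "coloured_adj c G (last (map f [0..<k])) (hd (map f [0..<k]))"
    using adj[of "k - 1"] assms by (simp add: last_map hd_map)
  ultimately have "is_cycle (coloured_adj c G) (verts G) (map f [0..<k])"
    using inj sub assms by (auto simp: is_cycle_def distinct_map atLeast0LessThan)
  then show "has_cycle (coloured_adj c G) (verts G) k"
    by (auto simp: has_cycle_def)
next
  assume "has_cycle (coloured_adj c G) (verts G) k"
  then obtain xs where xs: "is_cycle (coloured_adj c G) (verts G) xs" "length xs = k"
    by (auto simp: has_cycle_def)
  have adj: "coloured_adj c G (xs ! i) (xs ! (Suc i mod k))" if "i < k" for i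
  proof (cases "Suc i = k")
    case True
    then have "xs ! i = last xs" "xs ! 0 = hd xs"
      using xs last_conv_nth[of xs] hd_conv_nth[of xs] unfolding is_cycle_def by auto
    then show ?thesis
      using xs True by (simp add: is_cycle_def)
  next
    case False
    then show ?thesis
      using xs that by (simp add: is_cycle_def successively_conv_nth)
  qed
  have mem: "xs ! i \<in> verts G" if "i < k" for i
    using that xs nth_mem[of i xs] by (auto simp: is_cycle_def)
  have "subgraph ((!) xs ` fst (cycle k), (\<lambda>e. (!) xs ` e) ` snd (cycle k)) (colour_graph c G)"
    unfolding subgraph_def
  proof
    show "fst ((!) xs ` fst (cycle k), (\<lambda>e. (!) xs ` e) ` snd (cycle k)) \<subseteq> fst (colour_graph c G)"
      using mem by (auto simp: cycle_def colour_graph_def)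
    have "(!) xs ` {i, Suc i mod k} \<in> snd (colour_graph c G)" if "i < k" for i
      using adj[OF that] mem that doubleton_in_colour_graph by (metis image_empty image_insert
          mod_less_divisor not_less_zero zero_less_iff_neq_zero)
    then show "snd ((!) xs ` fst (cycle k), (\<lambda>e. (!) xs ` e) ` snd (cycle k)) \<subseteq> snd (colour_graph c G)"
      by (auto simp: cycle_def)
  qed
  moreover have "inj_on ((!) xs) (fst (cycle k))"
    using xs by (auto simp: cycle_def is_cycle_def inj_on_nth)
  ultimately show "contains_copy (cycle k) (colour_graph c G)"
    unfolding contains_copy_def by blast
qed

lemma contains_copy_cycles_iff:
  assumes "\<Gamma> \<subseteq> cycles"
  shows "(\<exists>H\<in>\<Gamma>. contains_copy H (colour_graph c G)) \<longleftrightarrow>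
    (\<exists>m\<ge>3. cycle m \<in> \<Gamma> \<and> has_cycle (coloured_adj c G) (verts G) m)"
proof -
  have "\<exists>m\<ge>3. H = cycle m" if "H \<in> \<Gamma>" for H
    using assms that unfolding cycles_def by blast
  then show ?thesis
    using contains_copy_cycle_iff[of _ c G] by metis
qed

lemma red_blue_relation_coloured_adj:
  "red_blue_graph G \<Longrightarrow> red_blue_relation (verts G) (coloured_adj Red G)"
  by unfold_locales (auto simp: red_blue_graph_def coloured_adj_def insert_commute)

lemma blue_adj_eq:
  assumes "red_blue_graph G"
  shows "red_blue_relation.B (coloured_adj Red G) = coloured_adj Blue G"
proof -
  have "col G e \<noteq> Red \<longleftrightarrow> col G e = Blue" for e
    by (cases "col G e") auto
  then show ?thesis
    by (auto simp: fun_eq_iff coloured_adj_def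
        red_blue_relation.B_def[OF red_blue_relation_coloured_adj[OF assms]])
qed

text \<open>The right-hand side of the final equivalence as one predicate. \<open>the_enat k\<close>
  matters only under \<open>k < enat (2 * n)\<close>, where \<open>k\<close> is finite.\<close>

definition bipartite_structure :: "nat \<Rightarrow> enat \<Rightarrow> 'a red_blue \<Rightarrow> bool" where
  "bipartite_structure n k G \<longleftrightarrow>
    (\<exists>A B p q. A \<union> B = verts G \<and> A \<inter> B = {} \<and> card A = p \<and> card B = q \<and>
       p + q = order G \<and> p \<ge> q \<and>
       subgraph (blue_graph G) (complete_bipartite A B) \<and>
       (enat (2 * n) > k \<longrightarrow>
          (p = n - 1 \<and> q = the_enat k div 2 - 1 \<and>
             (\<exists>v\<in>A. \<forall>e\<in>red_edges_between G A B. v \<in> e)) \<or>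
          (p = n - 2 \<and> q = the_enat k div 2 \<and>
             (\<exists>x\<in>B. card (red_edges_between G A {x}) \<in> {n - 3, n - 2} \<and>
                (\<forall>a\<in>A. \<forall>b\<in>B. b \<noteq> x \<longrightarrow> col G {a, b} = Blue)))) \<and>
       (enat (2 * n) \<le> k \<longrightarrow>
          p = n - 1 \<and> q = n - 1 \<and> card (red_edges_between G A B) \<le> 1))"

lemma red_edges_between_eq:
  assumes "A \<subseteq> verts G" "B \<subseteq> verts G"
  shows "red_edges_between G A B = {{a, b} | a b. a \<in> A \<and> b \<in> B \<and> coloured_adj Red G a b}"
  using assms doubleton_in_colour_graph[of _ _ Red G] unfolding red_edges_between_def by blast

lemma card_red_edges_between_singleton:
  assumes "A \<subseteq> verts G" "x \<in> verts G" "x \<notin> A"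
  shows "card (red_edges_between G A {x}) = card {a \<in> A. coloured_adj Red G a x}"
proof -
  have "red_edges_between G A {x} = (\<lambda>a. {a, x}) ` {a \<in> A. coloured_adj Red G a x}"
    using red_edges_between_eq[of A G "{x}"] assms by auto
  moreover have "inj_on (\<lambda>a. {a, x}) {a \<in> A. coloured_adj Red G a x}"
    by (auto simp: inj_on_def doubleton_eq_iff)
  ultimately show ?thesis
    by (simp add: card_image)
qed

lemma blue_subgraph_complete_bipartite_iff:
  assumes "A \<union> B = verts G" "A \<inter> B = {}"
  shows "subgraph (blue_graph G) (complete_bipartite A B) \<longleftrightarrow>
    (\<forall>u\<in>verts G. \<forall>v\<in>verts G. coloured_adj Blue G u v \<longrightarrow> (u \<in> A \<longleftrightarrow> v \<in> B))"
proof -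
  have "snd (blue_graph G) \<subseteq> snd (complete_bipartite A B) \<longleftrightarrow>
    (\<forall>u\<in>verts G. \<forall>v\<in>verts G. coloured_adj Blue G u v \<longrightarrow> {u, v} \<in> snd (complete_bipartite A B))"
    by (auto simp: colour_graph_def coloured_adj_def)
  moreover have "{u, v} \<in> snd (complete_bipartite A B) \<longleftrightarrow> (u \<in> A \<longleftrightarrow> v \<in> B)"
    if "u \<in> verts G" "v \<in> verts G" for u v
    using that assms by (auto simp: complete_bipartite_def doubleton_eq_iff)
  moreover have "fst (blue_graph G) \<subseteq> fst (complete_bipartite A B)"
    using assms by (auto simp: colour_graph_def complete_bipartite_def)
  ultimately show ?thesis
    unfolding subgraph_def by auto
qed

section \<open>Critical graphs\<close>

lemma finite_red_edges_between:
  assumes "finite (verts G)"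
  shows "finite (red_edges_between G A B)"
proof (rule finite_subset)
  have "snd (red_graph G) \<subseteq> Pow (verts G)"
    by (auto simp: colour_graph_def)
  then show "red_edges_between G A B \<subseteq> Pow (verts G)"
    unfolding red_edges_between_def by blast
qed (use assms in simp)

lemma bipartite_structureI:
  assumes "A \<union> B = verts G" "A \<inter> B = {}" "card A + card B = order G" "card B \<le> card A"
    "subgraph (blue_graph G) (complete_bipartite A B)"
    "k < enat (2 * n) \<Longrightarrow>
      card A = n - 1 \<and> card B = the_enat k div 2 - 1 \<and> (\<exists>v\<in>A. \<forall>e\<in>red_edges_between G A B. v \<in> e) \<or>
      card A = n - 2 \<and> card B = the_enat k div 2 \<and>
        (\<exists>x\<in>B. card (red_edges_between G A {x}) \<in> {n - 3, n - 2} \<and>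
          (\<forall>a\<in>A. \<forall>b\<in>B. b \<noteq> x \<longrightarrow> col G {a, b} = Blue))"
    "enat (2 * n) \<le> k \<Longrightarrow>
      card A = n - 1 \<and> card B = n - 1 \<and> card (red_edges_between G A B) \<le> 1"
  shows "bipartite_structure n k G"
  unfolding bipartite_structure_def
  by (rule exI[of _ A], rule exI[of _ B], rule exI[of _ "card A"], rule exI[of _ "card B"])
     (intro conjI impI refl assms; assumption)

lemma bipartite_structureE:
  assumes "bipartite_structure n k G"
  obtains A B where "A \<union> B = verts G" "A \<inter> B = {}" "card A + card B = order G" "card B \<le> card A"
    "subgraph (blue_graph G) (complete_bipartite A B)"
    "k < enat (2 * n) \<Longrightarrow>
      card A = n - 1 \<and> card B = the_enat k div 2 - 1 \<and> (\<exists>v\<in>A. \<forall>e\<in>red_edges_between G A B. v \<in> e) \<or>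
      card A = n - 2 \<and> card B = the_enat k div 2 \<and>
        (\<exists>x\<in>B. card (red_edges_between G A {x}) \<in> {n - 3, n - 2} \<and>
          (\<forall>a\<in>A. \<forall>b\<in>B. b \<noteq> x \<longrightarrow> col G {a, b} = Blue))"
    "enat (2 * n) \<le> k \<Longrightarrow>
      card A = n - 1 \<and> card B = n - 1 \<and> card (red_edges_between G A B) \<le> 1"
proof -
  obtain A B p q where *: "A \<union> B = verts G" "A \<inter> B = {}" "card A = p" "card B = q"
    "p + q = order G" "p \<ge> q" "subgraph (blue_graph G) (complete_bipartite A B)"
    "enat (2 * n) > k \<longrightarrow>
      (p = n - 1 \<and> q = the_enat k div 2 - 1 \<and> (\<exists>v\<in>A. \<forall>e\<in>red_edges_between G A B. v \<in> e)) \<or>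
      (p = n - 2 \<and> q = the_enat k div 2 \<and>
        (\<exists>x\<in>B. card (red_edges_between G A {x}) \<in> {n - 3, n - 2} \<and>
          (\<forall>a\<in>A. \<forall>b\<in>B. b \<noteq> x \<longrightarrow> col G {a, b} = Blue)))"
    "enat (2 * n) \<le> k \<longrightarrow> p = n - 1 \<and> q = n - 1 \<and> card (red_edges_between G A B) \<le> 1"
    using assms unfolding bipartite_structure_def by (elim exE conjE) (rule that)
  show thesis
    using *(3-6) *(8)[THEN mp] *(9)[THEN mp] by (intro that[OF *(1,2) _ _ *(7)]) simp_all
qed

lemma min_cycle_properties:
  assumes "\<Gamma> \<subseteq> cycles" "\<Gamma> \<noteq> {}"
  shows "3 \<le> min_cycle \<Gamma>" "cycle (min_cycle \<Gamma>) \<in> \<Gamma>"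
    "\<And>m. 3 \<le> m \<Longrightarrow> cycle m \<in> \<Gamma> \<Longrightarrow> min_cycle \<Gamma> \<le> m"
proof -
  obtain m where "3 \<le> m \<and> cycle m \<in> \<Gamma>"
    using assms unfolding cycles_def by blast
  then have "3 \<le> min_cycle \<Gamma> \<and> cycle (min_cycle \<Gamma>) \<in> \<Gamma>"
    unfolding min_cycle_def by (rule LeastI)
  then show "3 \<le> min_cycle \<Gamma>" "cycle (min_cycle \<Gamma>) \<in> \<Gamma>"
    by auto
  show "min_cycle \<Gamma> \<le> m" if "3 \<le> m" "cycle m \<in> \<Gamma>" for m
    unfolding min_cycle_def using that by (intro Least_le) blast
qed

section \<open>Cycle families and the extremal order\<close>

locale cycle_families =
  fixes \<Gamma>1 \<Gamma>2 :: "nat graph set" and n :: nat and k :: enat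
  assumes families: "\<Gamma>1 \<subseteq> cycles" "\<Gamma>1 \<noteq> {}" "\<Gamma>2 \<subseteq> cycles" "\<Gamma>2 \<noteq> {}"
    and n_def: "n = min_cycle \<Gamma>1" and k_def: "k = min_even_cycle \<Gamma>2"
    and shortest: "(n \<ge> 5 \<and> min_cycle \<Gamma>2 = 3) \<or> (n \<ge> 6 \<and> min_cycle \<Gamma>2 = 5 \<and> k \<ge> 8)"
begin

lemma k_le: "3 \<le> m \<Longrightarrow> even m \<Longrightarrow> cycle m \<in> \<Gamma>2 \<Longrightarrow> k \<le> enat m"
  unfolding k_def min_even_cycle_def by (intro Inf_lower) blast

lemma k_finite:
  assumes "k = enat m"
  shows "even m" "4 \<le> m" "cycle m \<in> \<Gamma>2"
proof -
  let ?S = "{enat j | j. 3 \<le> j \<and> even j \<and> cycle j \<in> \<Gamma>2}"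
  have "?S \<noteq> {}"
  proof
    assume "?S = {}"
    then have "k = \<infinity>"
      unfolding k_def min_even_cycle_def by (simp add: Inf_enat_def)
    then show False using assms by simp
  qed
  then have "Inf ?S \<in> ?S"
    unfolding Inf_enat_def by (auto intro: LeastI)
  then have "enat m \<in> ?S"
    using assms unfolding k_def min_even_cycle_def by simp
  then have m: "3 \<le> m" "even m" "cycle m \<in> \<Gamma>2"
    by auto
  then show "even m" "cycle m \<in> \<Gamma>2"
    by auto
  show "4 \<le> m"
    using m(1,2) by presburger
qed

lemma n_ge: "5 \<le> n"
  using shortest by auto

lemma avoiding_iff:
  "avoiding \<Gamma>1 \<Gamma>2 G \<longleftrightarrow>
    (\<forall>m\<ge>3. cycle m \<in> \<Gamma>1 \<longrightarrow> \<not> has_cycle (coloured_adj Red G) (verts G) m) \<and>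
    (\<forall>m\<ge>3. cycle m \<in> \<Gamma>2 \<longrightarrow> \<not> has_cycle (coloured_adj Blue G) (verts G) m)"
  unfolding avoiding_def contains_copy_cycles_iff[OF families(1)]
    contains_copy_cycles_iff[OF families(3)] by blast

text \<open>Red lengths below \<open>n\<close> and even blue lengths below \<open>k\<close> are
  absent from the families by minimality. The premise on length 3 sets aside single blue edges,
  which count as cycles of length two.\<close>

lemma avoidingI:
  assumes "\<And>xs. is_cycle (coloured_adj Red G) (verts G) xs \<Longrightarrow> length xs < n"
    "\<And>xs. is_cycle (coloured_adj Blue G) (verts G) xs \<Longrightarrow> 3 \<le> length xs \<Longrightarrow>
      even (length xs) \<and> enat (length xs) < k"
  shows "avoiding \<Gamma>1 \<Gamma>2 G"
  unfolding avoiding_iff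
proof (intro conjI allI impI notI)
  fix m
  assume m: "3 \<le> m" "cycle m \<in> \<Gamma>1" "has_cycle (coloured_adj Red G) (verts G) m"
  have "n \<le> m"
    unfolding n_def by (rule min_cycle_properties(3)[OF families(1,2) m(1,2)])
  then show False
    using m(3) assms(1) unfolding has_cycle_def by fastforce
next
  fix m
  assume m: "3 \<le> m" "cycle m \<in> \<Gamma>2" "has_cycle (coloured_adj Blue G) (verts G) m"
  then have "even m" "enat m < k"
    using assms(2) unfolding has_cycle_def by blast+
  then show False
    using k_le[OF m(1) _ m(2)] by simp
qed

text \<open>One less than the Ramsey number: (n - 1) + (k/2 - 1) = (n - 2) + k/2 in the bounded
  case, (n - 1) + (n - 1) otherwise.\<close>

definition extremal_order :: nat where
  "extremal_order = (if k < enat (2 * n) then n + the_enat k div 2 - 2 else 2 * n - 2)"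

lemma k_bounded:
  assumes "k < enat (2 * n)"
  obtains r where "k = enat (2 * r)" "2 \<le> r" "r < n" "cycle (2 * r) \<in> \<Gamma>2"
    "the_enat k div 2 = r" "extremal_order = n + r - 2"
    "min_cycle \<Gamma>2 = 5 \<Longrightarrow> 4 \<le> r"
proof -
  obtain m where m: "k = enat m"
    using assms by (cases k) auto
  note fin = k_finite[OF m]
  then obtain r where r: "m = 2 * r" by blast
  have "8 \<le> m" if "min_cycle \<Gamma>2 = 5"
    using shortest that unfolding m by (simp add: numeral_eq_enat)
  moreover have "extremal_order = n + r - 2"
    using assms unfolding extremal_order_def unfolding m r by simp
  ultimately show thesis
    using that[of r] fin assms m r by auto
qed

lemma avoiding_bipartition:
  assumes G: "red_blue_graph G" and avoid: "avoiding \<Gamma>1 \<Gamma>2 G" and order: "extremal_order \<le> order G"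
  obtains X Y where "X \<union> Y = verts G" "X \<inter> Y = {}"
    "red_blue_relation.red_clique (coloured_adj Red G) X"
    "red_blue_relation.red_clique (coloured_adj Red G) Y"
proof -
  interpret red_blue_relation "verts G" "coloured_adj Red G"
    using red_blue_relation_coloured_adj[OF G] .
  note blue = blue_adj_eq[OF G]
  have noR: "\<not> has_cycle (coloured_adj Red G) (verts G) n"
    using avoid min_cycle_properties(1,2)[OF families(1,2)] unfolding avoiding_iff n_def by blast
  have noB: "\<not> has_cycle B (verts G) (min_cycle \<Gamma>2)"
    using avoid min_cycle_properties(1,2)[OF families(3,4)] unfolding avoiding_iff blue by blast
  have card: "n \<le> card (verts G) \<and> (min_cycle \<Gamma>2 = 5 \<longrightarrow> n + 2 \<le> card (verts G))"
  proof (cases "k < enat (2 * n)")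
    case True
    then obtain r where "2 \<le> r" "extremal_order = n + r - 2" "min_cycle \<Gamma>2 = 5 \<Longrightarrow> 4 \<le> r"
      using k_bounded by metis
    then show ?thesis
      using order unfolding order_def by auto
  next
    case False
    then show ?thesis
      using order n_ge unfolding order_def extremal_order_def by auto
  qed
  from shortest show thesis
  proof
    assume *: "n \<ge> 5 \<and> min_cycle \<Gamma>2 = 3"
    then show thesis
      using red_bipartition_triangle[OF _ noR] noB card that by metis
  next
    assume "n \<ge> 6 \<and> min_cycle \<Gamma>2 = 5 \<and> k \<ge> 8"
    then show thesis
      using red_bipartition_pentagon[OF _ noR] noB card that by metis
  qed
qed

lemma avoiding_bipartite_structure:
  assumes G: "red_blue_graph G" and avoid: "avoiding \<Gamma>1 \<Gamma>2 G" and order: "extremal_order \<le> order G"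
  shows "order G = extremal_order \<and> bipartite_structure n k G"
proof -
  interpret red_blue_relation "verts G" "coloured_adj Red G"
    using red_blue_relation_coloured_adj[OF G] .
  note blue = blue_adj_eq[OF G]
  have noR: "\<not> has_cycle (coloured_adj Red G) (verts G) n"
    using avoid min_cycle_properties(1,2)[OF families(1,2)] unfolding avoiding_iff n_def by blast
  obtain X Y where part: "X \<union> Y = verts G" "X \<inter> Y = {}" "red_clique X" "red_clique Y"
    using avoiding_bipartition[OF assms] by metis
  have sub: "subgraph (blue_graph G) (complete_bipartite P Q)"
    if "P \<union> Q = verts G" "P \<inter> Q = {}" "red_clique P" "red_clique Q" for P Q
    unfolding blue_subgraph_complete_bipartite_iff[OF that(1,2)]
  proof (intro ballI impI)
    fix u v
    assume uv: "u \<in> verts G" "v \<in> verts G" "coloured_adj Blue G u v"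
    then have "\<not> coloured_adj Red G u v" "u \<noteq> v"
      by (auto simp: coloured_adj_def)
    then show "u \<in> P \<longleftrightarrow> v \<in> Q"
      using red_cliqueD[OF that(3)] red_cliqueD[OF that(4)] that(1,2) uv by blast
  qed
  have sum: "card P + card Q = order G" if "P \<union> Q = verts G" "P \<inter> Q = {}" for P Q
    using that finite_V card_Un_disjoint[of P Q] unfolding order_def
    by (metis finite_Un)
  show ?thesis
  proof (cases "k < enat (2 * n)")
    case True
    then obtain r where r: "k = enat (2 * r)" "2 \<le> r" "r < n" "cycle (2 * r) \<in> \<Gamma>2"
      "the_enat k div 2 = r" "extremal_order = n + r - 2"
      using k_bounded by metis
    have noB: "\<not> has_cycle B (verts G) (2 * r)"
      using avoid r(2,4) unfolding avoiding_iff blue by simp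
    have card: "n + r \<le> card (verts G) + 2"
      using order r(6) unfolding order_def by simp
    obtain P Q where PQ: "card (verts G) + 2 = n + r" "P \<union> Q = verts G" "P \<inter> Q = {}"
      "red_clique P" "red_clique Q" "card Q \<le> card P"
      and struct: "card P = n - 1 \<and> card Q = r - 1 \<and>
          (\<exists>v\<in>P. \<forall>a\<in>P. \<forall>b\<in>Q. coloured_adj Red G a b \<longrightarrow> a = v) \<or>
        card P = n - 2 \<and> card Q = r \<and>
          (\<exists>x\<in>Q. card {a \<in> P. coloured_adj Red G a x} \<in> {n - 3, n - 2} \<and>
            (\<forall>a\<in>P. \<forall>b\<in>Q. b \<noteq> x \<longrightarrow> B a b))"
      by (rule bipartition_structure_bounded[OF part noR noB r(2,3) n_ge card])
    have PV: "P \<subseteq> verts G" "Q \<subseteq> verts G"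
      using PQ(2) by auto
    note between = red_edges_between_eq[OF PV]
    have "card P = n - 1 \<and> card Q = r - 1 \<and> (\<exists>v\<in>P. \<forall>e\<in>red_edges_between G P Q. v \<in> e) \<or>
        card P = n - 2 \<and> card Q = r \<and>
          (\<exists>x\<in>Q. card (red_edges_between G P {x}) \<in> {n - 3, n - 2} \<and>
            (\<forall>a\<in>P. \<forall>b\<in>Q. b \<noteq> x \<longrightarrow> col G {a, b} = Blue))"
      using struct
    proof (elim disjE conjE bexE)
      fix v assume "card P = n - 1" "card Q = r - 1" "v \<in> P"
        "\<forall>a\<in>P. \<forall>b\<in>Q. coloured_adj Red G a b \<longrightarrow> a = v"
      then show ?thesis
        unfolding between by blast
    next
      fix x assume *: "card P = n - 2" "card Q = r" "x \<in> Q"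
        "card {a \<in> P. coloured_adj Red G a x} \<in> {n - 3, n - 2}"
        "\<forall>a\<in>P. \<forall>b\<in>Q. b \<noteq> x \<longrightarrow> B a b"
      have "card (red_edges_between G P {x}) = card {a \<in> P. coloured_adj Red G a x}"
        using *(3) PV PQ(3) by (intro card_red_edges_between_singleton) auto
      then show ?thesis
        using * unfolding blue coloured_adj_def by auto
    qed
    then have "bipartite_structure n k G"
      using True unfolding r(5)[symmetric]
      by (intro bipartite_structureI[OF PQ(2,3) sum[OF PQ(2,3)] PQ(6) sub[OF PQ(2-5)]]) simp_all
    then show ?thesis
      using PQ(1) r(6) unfolding order_def by simp
  next
    case False
    then have "2 * n \<le> card (verts G) + 2"
      using order n_ge unfolding order_def extremal_order_def by auto
    then have *: "card (verts G) + 2 = 2 * n" "card X = n - 1" "card Y = n - 1"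
      "\<And>a b a' b'. a \<in> X \<Longrightarrow> a' \<in> X \<Longrightarrow> b \<in> Y \<Longrightarrow> b' \<in> Y \<Longrightarrow> coloured_adj Red G a b \<Longrightarrow>
        coloured_adj Red G a' b' \<Longrightarrow> a = a' \<and> b = b'"
      by (rule bipartition_structure_unbounded[OF part noR n_ge], blast+)+
    have XY: "X \<subseteq> verts G" "Y \<subseteq> verts G"
      using part by auto
    have "finite (red_edges_between G X Y)"
      using finite_red_edges_between G by (simp add: red_blue_graph_def)
    moreover have "e = e'" if "e \<in> red_edges_between G X Y" "e' \<in> red_edges_between G X Y" for e e'
      using that *(4) unfolding red_edges_between_eq[OF XY] by blast
    ultimately have "card (red_edges_between G X Y) \<le> 1"
      by (simp add: card_le_Suc0_iff_eq)
    then have "bipartite_structure n k G"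
      using False *(2,3)
      by (intro bipartite_structureI[OF part(1,2) sum[OF part(1,2)] _ sub[OF part]]) simp_all
    then show ?thesis
      using *(1) False unfolding order_def extremal_order_def by simp
  qed
qed

section \<open>The structured graphs avoid both families\<close>

lemma bipartite_blue_cycle:
  assumes "A \<union> B = verts G" "A \<inter> B = {}" "subgraph (blue_graph G) (complete_bipartite A B)"
    "is_cycle (coloured_adj Blue G) (verts G) xs"
  shows "length xs = 2 * card (set xs \<inter> B)"
proof (rule cycle_bipartite)
  \<comment> \<open>Adjacency is restricted to \<open>verts G\<close>, because colours outside the
    graph are arbitrary and need not respect the bipartition.\<close>
  show "is_cycle (\<lambda>u v. u \<in> verts G \<and> v \<in> verts G \<and> coloured_adj Blue G u v) (verts G) xs"
    using assms(4) successively_mono[of "coloured_adj Blue G" xs]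
    by (auto simp: is_cycle_def successively_conv_nth)
qed (use assms blue_subgraph_complete_bipartite_iff[OF assms(1,2)] in auto)

lemma bipartite_structure_avoiding:
  assumes G: "red_blue_graph G" and struct: "bipartite_structure n k G"
  shows "order G = extremal_order \<and> avoiding \<Gamma>1 \<Gamma>2 G"
proof -
  obtain A B where AB: "A \<union> B = verts G" "A \<inter> B = {}" "card A + card B = order G" "card B \<le> card A"
    and sub: "subgraph (blue_graph G) (complete_bipartite A B)"
    and bounded: "k < enat (2 * n) \<Longrightarrow>
      card A = n - 1 \<and> card B = the_enat k div 2 - 1 \<and> (\<exists>v\<in>A. \<forall>e\<in>red_edges_between G A B. v \<in> e) \<or>
      card A = n - 2 \<and> card B = the_enat k div 2 \<and>
        (\<exists>x\<in>B. card (red_edges_between G A {x}) \<in> {n - 3, n - 2} \<and>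
          (\<forall>a\<in>A. \<forall>b\<in>B. b \<noteq> x \<longrightarrow> col G {a, b} = Blue))"
    and unbounded: "enat (2 * n) \<le> k \<Longrightarrow>
      card A = n - 1 \<and> card B = n - 1 \<and> card (red_edges_between G A B) \<le> 1"
    by (rule bipartite_structureE[OF struct]) blast
  have fin: "finite (verts G)"
    using G by (simp add: red_blue_graph_def)
  have sub': "A \<subseteq> verts G" "B \<subseteq> verts G"
    using AB(1) by auto
  have finAB: "finite A" "finite B"
    using fin sub' finite_subset by blast+
  note between = red_edges_between_eq[OF sub']
  have len: "length xs \<le> card S" if "is_cycle E (verts G) xs" "set xs \<subseteq> S" "finite S" for E xs S
    using that by (metis card_mono distinct_card is_cycle_def)
  \<comment> \<open>A red cycle stays in \<open>A\<close>, which contains the centre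
    \<open>v\<close>, or in \<open>B\<close> with \<open>v\<close> added; hence the sharper bound
    \<open>n - 1\<close> for \<open>B\<close>.\<close>
  have red: "length xs < n" if "v \<in> A" "\<And>a b. a \<in> A - {v} \<Longrightarrow> b \<in> B \<Longrightarrow> \<not> coloured_adj Red G a b"
    "card A < n" "card B < n - 1" "is_cycle (coloured_adj Red G) (verts G) xs" for v xs
  proof -
    have "set xs \<subseteq> insert v A \<or> set xs \<subseteq> insert v B"
      using that(2) AB(1) coloured_adj_commute[of Red G]
      by (intro cycle_through_cut_vertex[OF that(5)]) auto
    moreover have "card (insert v A) < n" "card (insert v B) < n"
      using that(1,3,4) finAB card_insert_if[of B v] by (auto simp: insert_absorb split: if_splits)
    ultimately show ?thesis
      using len[OF that(5), of "insert v A"] len[OF that(5), of "insert v B"] finAB by auto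
  qed
  note blue = bipartite_blue_cycle[OF AB(1,2) sub]
  have side: "u \<in> A \<longleftrightarrow> v \<in> B" if "u \<in> verts G" "v \<in> verts G" "coloured_adj Blue G u v" for u v
    using sub that unfolding blue_subgraph_complete_bipartite_iff[OF AB(1,2)] by simp
  show ?thesis
  proof (cases "k < enat (2 * n)")
    case True
    then obtain r where r: "k = enat (2 * r)" "2 \<le> r" "r < n" "the_enat k div 2 = r"
      "extremal_order = n + r - 2"
      using k_bounded by metis
    consider v where "card A = n - 1" "card B = r - 1" "v \<in> A" "\<forall>e\<in>red_edges_between G A B. v \<in> e"
      | x where "card A = n - 2" "card B = r" "x \<in> B"
        "card (red_edges_between G A {x}) \<in> {n - 3, n - 2}"
        "\<forall>a\<in>A. \<forall>b\<in>B. b \<noteq> x \<longrightarrow> col G {a, b} = Blue"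
      using bounded[OF True] r(4) by blast
    then show ?thesis
    proof cases
      case 1
      have cross: "\<not> coloured_adj Red G a b" if "a \<in> A - {v}" "b \<in> B" for a b
      proof
        assume "coloured_adj Red G a b"
        then have "{a, b} \<in> red_edges_between G A B"
          using that unfolding between by (intro CollectI exI[of _ a] exI[of _ b] conjI refl) auto
        then have "v \<in> {a, b}"
          by (rule bspec[OF 1(4)])
        then show False
          using that 1(3) AB(2) by blast
      qed
      have "avoiding \<Gamma>1 \<Gamma>2 G"
      proof (rule avoidingI)
        show "length xs < n" if "is_cycle (coloured_adj Red G) (verts G) xs" for xs
          using red[OF 1(3) cross _ _ that] 1 r n_ge by auto
        show "even (length xs) \<and> enat (length xs) < k"
          if "is_cycle (coloured_adj Blue G) (verts G) xs" for xs
        proof -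
          have "card (set xs \<inter> B) < r"
            using card_mono[OF finAB(2), of "set xs \<inter> B"] 1(2) r(2) by auto
          then show ?thesis
            using blue[OF that] r(1) by simp
        qed
      qed
      then show ?thesis
        using 1 r AB(3) n_ge by auto
    next
      case 2
      have nbrs: "n - 3 \<le> card {a \<in> A. coloured_adj Red G a x}"
      proof -
        have "x \<in> verts G" "x \<notin> A"
          using 2(3) sub'(2) AB(2) by blast+
        then show ?thesis
          using card_red_edges_between_singleton[OF sub'(1)] 2(4) by auto
      qed
      have "avoiding \<Gamma>1 \<Gamma>2 G"
      proof (rule avoidingI)
        show "length xs < n" if cyc: "is_cycle (coloured_adj Red G) (verts G) xs" for xs
        proof -
          have "set xs \<subseteq> insert x A \<or> set xs \<subseteq> insert x B"
            using 2(5) AB(1) coloured_adj_commute[of Red G]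
            by (intro cycle_through_cut_vertex[OF cyc]) (auto simp: coloured_adj_def)
          moreover have "card (insert x A) < n" "card (insert x B) < n"
            using 2(1-3) r(3) n_ge finAB card_insert_if[of A x] by (auto simp: insert_absorb split: if_splits)
          ultimately show ?thesis
            using len[OF cyc, of "insert x A"] len[OF cyc, of "insert x B"] finAB by auto
        qed
        show "even (length xs) \<and> enat (length xs) < k"
          if cyc: "is_cycle (coloured_adj Blue G) (verts G) xs" and three: "3 \<le> length xs" for xs
        proof -
          \<comment> \<open>\<open>B\<close> has \<open>r\<close> vertices, so a blue cycle of
            length \<open>2 * r\<close> would use two blue edges at \<open>x\<close>; but
            \<open>x\<close> is red to at least \<open>n - 3\<close> of the \<open>n - 2\<close>
            vertices of \<open>A\<close>.\<close>
          have "card (set xs \<inter> B) < r"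
          proof (rule ccontr)
            assume "\<not> ?thesis"
            then have "set xs \<inter> B = B"
              using card_seteq[OF finAB(2), of "set xs \<inter> B"] 2(2) by auto
            then have "x \<in> set xs"
              using 2(3) by blast
            then obtain ys where ys: "is_cycle (coloured_adj Blue G) (verts G) (x # ys)"
              "length (x # ys) = length xs"
              using is_cycle_Cons_obtain[OF cyc] by metis
            obtain c ds where ys_eq: "ys = c # ds" "ds \<noteq> []"
              using ys(2) three by (cases ys; cases "tl ys") auto
            define d where "d = last ds"
            have "coloured_adj Blue G d x"
              using ys(1) ys_eq unfolding d_def is_cycle_def by auto
            then have cd: "coloured_adj Blue G x d" "coloured_adj Blue G x c" "c \<noteq> d"
              "c \<in> verts G" "d \<in> verts G" "x \<in> verts G"
              using ys(1) ys_eq last_in_set[of ds] coloured_adj_commute[of Blue G d x]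
              unfolding d_def is_cycle_def by auto
            have "x \<notin> A"
              using 2(3) AB(2) by blast
            then have "c \<notin> B" "d \<notin> B"
              using side[OF cd(6,4,2)] side[OF cd(6,5,1)] by blast+
            then have "c \<in> A" "d \<in> A"
              using cd(4,5) AB(1) by blast+
            moreover have "{a \<in> A. coloured_adj Red G a x} \<subseteq> A - {c, d}"
              using cd by (auto simp: coloured_adj_def insert_commute)
            ultimately have "card {a \<in> A. coloured_adj Red G a x} \<le> card A - 2"
              using card_mono[of "A - {c, d}"] finAB cd(3)
              by (simp add: card_Diff_subset numeral_2_eq_2)
            then show False
              using nbrs 2(1) n_ge by linarith
          qed
          then show ?thesis
            using blue[OF cyc] r(1) by simp
        qed
      qed
      then show ?thesis
        using 2 r AB(3) n_ge by auto
    qed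
  next
    case False
    then have k: "enat (2 * n) \<le> k"
      by simp
    note un = unbounded[OF k]
    have "finite (red_edges_between G A B)"
      using finite_red_edges_between[OF fin] .
    then have same: "e = e'" if "e \<in> red_edges_between G A B" "e' \<in> red_edges_between G A B" for e e'
      using un that by (simp add: card_le_Suc0_iff_eq)
    have "A \<noteq> {}" "B \<noteq> {}"
      using un n_ge by auto
    \<comment> \<open>Without a red cross edge any pair \<open>a\<close>, \<open>b\<close>
      serves.\<close>
    then obtain a b where ab: "a \<in> A" "b \<in> B"
      and only: "\<And>a' b'. a' \<in> A \<Longrightarrow> b' \<in> B \<Longrightarrow> coloured_adj Red G a' b' \<Longrightarrow> a' = a \<and> b' = b"
    proof (cases "\<exists>a\<in>A. \<exists>b\<in>B. coloured_adj Red G a b")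
      case True
      then obtain a b where e: "a \<in> A" "b \<in> B" "coloured_adj Red G a b"
        by blast
      have "a' = a \<and> b' = b" if "a' \<in> A" "b' \<in> B" "coloured_adj Red G a' b'" for a' b'
      proof -
        have "{a', b'} = {a, b}"
          using same e that unfolding between by blast
        then show ?thesis
          using e that AB(2) by (auto simp: doubleton_eq_iff)
      qed
      then show thesis
        using that e by blast
    qed blast
    have "avoiding \<Gamma>1 \<Gamma>2 G"
    proof (rule avoidingI)
      show "length xs < n" if cyc: "is_cycle (coloured_adj Red G) (verts G) xs" for xs
      proof -
        have "set xs \<subseteq> insert a A \<or> set xs \<subseteq> insert a B"
          using only AB(1) coloured_adj_commute[of Red G]
          by (intro cycle_through_cut_vertex[OF cyc]) auto
        moreover have "set xs \<subseteq> insert b A \<or> set xs \<subseteq> insert b B"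
          using only AB(1) coloured_adj_commute[of Red G]
          by (intro cycle_through_cut_vertex[OF cyc]) auto
        \<comment> \<open>The cut vertex \<open>a\<close> alone would allow \<open>B\<close> with
          \<open>a\<close> added, which has \<open>n\<close> vertices. Using both ends of the only
          possible red cross edge sharpens the inclusion.\<close>
        ultimately have "set xs \<subseteq> A \<or> set xs \<subseteq> B \<or> set xs \<subseteq> {a, b}"
          using ab AB(2) by blast
        moreover have "card A < n" "card B < n" "card {a, b} < n"
          using un n_ge card_insert_le_m1[of 2 "{b}" a] by auto
        ultimately show ?thesis
          using len[OF cyc, of A] len[OF cyc, of B] len[OF cyc, of "{a, b}"] finAB by auto
      qed
      show "even (length xs) \<and> enat (length xs) < k"
        if "is_cycle (coloured_adj Blue G) (verts G) xs" for xs
      proof -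
        have "card (set xs \<inter> B) < n"
          using card_mono[OF finAB(2), of "set xs \<inter> B"] un n_ge by auto
        then have "enat (length xs) < enat (2 * n)"
          using blue[OF that] by simp
        then have "enat (length xs) < k"
          using k by (rule order_less_le_trans)
        then show ?thesis
          using blue[OF that] by simp
      qed
    qed
    then show ?thesis
      using un AB(3) False n_ge by (auto simp: extremal_order_def)
  qed
qed

text \<open>Minimality in the Ramsey number calls for an avoiding graph of every order up to the
  extremal one. The first \<open>n - 1\<close> vertices face the remaining ones, with all cross
  edges blue and all others red; the bound on \<open>N\<close> keeps the second part below both
  \<open>n\<close> and k/2.\<close>

lemma avoiding_nat_exists:
  assumes "N \<le> extremal_order"
  shows "\<exists>G :: nat red_blue. red_blue_graph G \<and> order G = N \<and> avoiding \<Gamma>1 \<Gamma>2 G"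
proof -
  define G :: "nat red_blue" where
    "G = \<lparr>verts = {..<N}, col = (\<lambda>e. if (\<exists>i\<in>e. i < n - 1) \<and> (\<exists>j\<in>e. n - 1 \<le> j) then Blue else Red)\<rparr>"
  let ?A = "{..<N} \<inter> {..<n - 1}" and ?B = "{n - 1..<N}"
  have AB: "?A \<union> ?B = verts G" "?A \<inter> ?B = {}"
    by (auto simp: G_def)
  have blue: "coloured_adj Blue G u v \<longleftrightarrow> (u < n - 1 \<and> n - 1 \<le> v \<or> v < n - 1 \<and> n - 1 \<le> u)" for u v
    by (auto simp: coloured_adj_def G_def)
  have red: "\<not> coloured_adj Red G u v" if "u < n - 1" "n - 1 \<le> v" for u v
    using that by (auto simp: coloured_adj_def G_def)
  have sub: "subgraph (blue_graph G) (complete_bipartite ?A ?B)"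
    unfolding blue_subgraph_complete_bipartite_iff[OF AB] blue by (auto simp: G_def)
  have B: "card ?B < n \<and> enat (2 * card ?B) < k"
  proof (cases "k < enat (2 * n)")
    case True
    then obtain r where "k = enat (2 * r)" "2 \<le> r" "r < n" "extremal_order = n + r - 2"
      using k_bounded by metis
    then show ?thesis
      using assms n_ge by auto
  next
    case False
    then have "card ?B < n"
      using assms n_ge by (auto simp: extremal_order_def)
    then have "enat (2 * card ?B) < enat (2 * n)"
      by simp
    then show ?thesis
      using False \<open>card ?B < n\<close> by (meson not_less order_less_le_trans)
  qed
  have "avoiding \<Gamma>1 \<Gamma>2 G"
  proof (rule avoidingI)
    show "length xs < n" if cyc: "is_cycle (coloured_adj Red G) (verts G) xs" for xs
    proof -
      \<comment> \<open>No red edge crosses, so \<open>N\<close>, which is not a vertex, plays the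
        cut vertex.\<close>
      have "set xs \<subseteq> insert N ?A \<or> set xs \<subseteq> insert N ?B"
        using red coloured_adj_commute[of Red G] AB(1)
        by (intro cycle_through_cut_vertex[OF cyc]) auto
      moreover have "N \<notin> set xs" "length xs = card (set xs)"
        using cyc by (auto simp: is_cycle_def G_def distinct_card)
      ultimately have "set xs \<subseteq> ?A \<or> set xs \<subseteq> ?B"
        by blast
      then have "length xs \<le> card ?A \<or> length xs \<le> card ?B"
        using card_mono[of ?A "set xs"] card_mono[of ?B "set xs"] \<open>length xs = card (set xs)\<close> by auto
      moreover have "card ?A \<le> card {..<n - 1}"
        by (intro card_mono) auto
      ultimately show ?thesis
        using B n_ge by auto
    qed
    show "even (length xs) \<and> enat (length xs) < k"
      if cyc: "is_cycle (coloured_adj Blue G) (verts G) xs" for xs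
    proof -
      have "length xs = 2 * card (set xs \<inter> ?B)"
        by (rule bipartite_blue_cycle[OF AB sub cyc])
      moreover have "card (set xs \<inter> ?B) \<le> card ?B"
        by (intro card_mono) auto
      ultimately show ?thesis
        using B by (metis dvd_triv_left enat_ord_simps(1) mult_le_mono2 order_le_less_trans)
    qed
  qed
  moreover have "red_blue_graph G" "order G = N"
    by (auto simp: red_blue_graph_def order_def G_def)
  ultimately show ?thesis by blast
qed

text \<open>An avoiding graph of order \<open>extremal_order + 1\<close> would have order
  \<open>extremal_order\<close> by the structure result; up to that order avoiding graphs
  exist.\<close>

lemma ramsey_number_eq: "ramsey_number \<Gamma>1 \<Gamma>2 = extremal_order + 1"
proof -
  let ?P = "\<lambda>N. 0 < N \<and> (\<forall>G :: nat red_blue. red_blue_graph G \<and> order G = N \<longrightarrow> \<not> avoiding \<Gamma>1 \<Gamma>2 G)"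
  have "ramsey_number \<Gamma>1 \<Gamma>2 = (LEAST N. ?P N)"
    unfolding ramsey_number_def avoiding_def by (simp only: de_Morgan_conj not_not)
  also have "\<dots> = extremal_order + 1"
  proof (rule Least_equality)
    show "?P (extremal_order + 1)"
      using avoiding_bipartite_structure by fastforce
    show "extremal_order + 1 \<le> N" if "?P N" for N
      using avoiding_nat_exists[of N] that by fastforce
  qed
  finally show ?thesis .
qed

lemma critical_iff:
  assumes "red_blue_graph G"
  shows "critical \<Gamma>1 \<Gamma>2 G \<longleftrightarrow> bipartite_structure n k G"
  using avoiding_bipartite_structure[OF assms] bipartite_structure_avoiding[OF assms]
  unfolding critical_def ramsey_number_eq by auto

end

theorem theorem4p11:
  fixes \<Gamma>1 \<Gamma>2 :: "nat graph set" and n :: nat and k :: enat and G :: "'a red_blue"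
  assumes "\<Gamma>1 \<subseteq> cycles" and "\<Gamma>1 \<noteq> {}"
    and "\<Gamma>2 \<subseteq> cycles" and "\<Gamma>2 \<noteq> {}"
    and "n = min_cycle \<Gamma>1" and "k = min_even_cycle \<Gamma>2"
    and "(n \<ge> 5 \<and> min_cycle \<Gamma>2 = 3) \<or> (n \<ge> 6 \<and> min_cycle \<Gamma>2 = 5 \<and> k \<ge> 8)"
    and "red_blue_graph G"
  shows "critical \<Gamma>1 \<Gamma>2 G \<longleftrightarrow>
    (\<exists>A B p q. A \<union> B = verts G \<and> A \<inter> B = {} \<and> card A = p \<and> card B = q \<and>
       p + q = order G \<and> p \<ge> q \<and>
       subgraph (blue_graph G) (complete_bipartite A B) \<and>
       (enat (2 * n) > k \<longrightarrow>
          (p = n - 1 \<and> q = the_enat k div 2 - 1 \<and>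
             (\<exists>v\<in>A. \<forall>e\<in>red_edges_between G A B. v \<in> e)) \<or>
          (p = n - 2 \<and> q = the_enat k div 2 \<and>
             (\<exists>x\<in>B. card (red_edges_between G A {x}) \<in> {n - 3, n - 2} \<and>
                (\<forall>a\<in>A. \<forall>b\<in>B. b \<noteq> x \<longrightarrow> col G {a, b} = Blue)))) \<and>
       (enat (2 * n) \<le> k \<longrightarrow>
          p = n - 1 \<and> q = n - 1 \<and> card (red_edges_between G A B) \<le> 1))"
proof -
  interpret cycle_families \<Gamma>1 \<Gamma>2 n k
    using assms(1-7) by unfold_locales
  show ?thesis
    using critical_iff[OF assms(8)] unfolding bipartite_structure_def .
qed

end
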